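(* Let $S^1\hookrightarrow P\xrightarrow{p}F_g$ be a principal $S^1$-bundle with even Chern class over the closed oriented surface $F_g$ of genus $g\ge1$. Any two special $2$-fold coverings $E_\varphi\to P$ and $E_{\varphi'}\to P$ are weakly equivalent, in the sense that there exists an automorphism $f$ of $\pi_1(P)$ such that $\varphi=\varphi'\circ f$.
   Context: Let $u_0\in\pi_1(P)$ be the image of a generator of $\pi_1(S^1)$ (the fiber). A $2$-fold covering $E_\varphi\to P$ with monodromy $\varphi\colon\pi_1(P)\to\mathbb{Z}_2$ (so that $1\to\pi_1(E_\varphi)\to\pi_1(P)\xrightarrow{\varphi}\mathbb{Z}_2\to0$ is exact) is called special if $\varphi(u_0)=1$, the nontrivial element of $\mathbb{Z}_2$. *)

theory Defs
  imports
    "HOL-Complex_Analysis.Winding_Numbers"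
    "HOL-Algebra.Elementary_Groups"
begin

section \<open>The fundamental group\<close>

definition based_loops :: "'a::topological_space set \<Rightarrow> 'a \<Rightarrow> (real \<Rightarrow> 'a) set" where
  "based_loops X x =
     {\<gamma>. path \<gamma> \<and> path_image \<gamma> \<subseteq> X \<and> pathstart \<gamma> = x \<and> pathfinish \<gamma> = x}"

definition path_class :: "'a::topological_space set \<Rightarrow> (real \<Rightarrow> 'a) \<Rightarrow> (real \<Rightarrow> 'a) set" where
  "path_class X \<gamma> = {\<delta>. homotopic_paths X \<gamma> \<delta>}"

definition fundamental_group ::
  "'a::topological_space set \<Rightarrow> 'a \<Rightarrow> (real \<Rightarrow> 'a) set monoid" where
  "fundamental_group X x =
     \<lparr>carrier = path_class X ` based_loops X x,
      monoid.mult = (\<lambda>A B. \<Union>\<alpha>\<in>A. \<Union>\<beta>\<in>B. path_class X (\<alpha> +++ \<beta>)),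
      one = path_class X (\<lambda>_. x)\<rparr>"

definition fundamental_map ::
  "'b::topological_space set \<Rightarrow> ('a::topological_space \<Rightarrow> 'b) \<Rightarrow> (real \<Rightarrow> 'a) set \<Rightarrow> (real \<Rightarrow> 'b) set"
  where
  "fundamental_map Y f A = (\<Union>\<alpha>\<in>A. path_class Y (f \<circ> \<alpha>))"

lemma path_class_eq:
  assumes "homotopic_paths X \<gamma> \<delta>"
  shows "path_class X \<gamma> = path_class X \<delta>"
  using assms unfolding path_class_def
  by (blast intro: homotopic_paths_trans homotopic_paths_sym)

lemma path_class_self:
  "\<gamma> \<in> based_loops X x \<Longrightarrow> \<gamma> \<in> path_class X \<gamma>"
  by (simp add: path_class_def based_loops_def)

lemma based_loops_join:
  "\<alpha> \<in> based_loops X x \<Longrightarrow> \<beta> \<in> based_loops X x \<Longrightarrow> \<alpha> +++ \<beta> \<in> based_loops X x"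
  by (auto simp: based_loops_def path_image_join)

lemma based_loops_const: "x \<in> X \<Longrightarrow> (\<lambda>_. x) \<in> based_loops X x"
  by (auto simp: based_loops_def path_def path_image_def pathstart_def pathfinish_def)

lemma based_loops_reverse:
  "\<alpha> \<in> based_loops X x \<Longrightarrow> reversepath \<alpha> \<in> based_loops X x"
  by (auto simp: based_loops_def)

lemma fundamental_group_mult:
  assumes "\<alpha> \<in> based_loops X x" "\<beta> \<in> based_loops X x"
  shows "monoid.mult (fundamental_group X x) (path_class X \<alpha>) (path_class X \<beta>)
           = path_class X (\<alpha> +++ \<beta>)"
proof -
  have "path_class X (\<alpha>' +++ \<beta>') = path_class X (\<alpha> +++ \<beta>)"
    if "\<alpha>' \<in> path_class X \<alpha>" "\<beta>' \<in> path_class X \<beta>" for \<alpha>' \<beta>'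
    using that assms
    by (intro path_class_eq homotopic_paths_sym[OF homotopic_paths_join])
       (auto simp: path_class_def based_loops_def)
  then have "(\<Union>\<alpha>'\<in>path_class X \<alpha>. \<Union>\<beta>'\<in>path_class X \<beta>. path_class X (\<alpha>' +++ \<beta>'))
      = (\<Union>\<alpha>'\<in>path_class X \<alpha>. \<Union>\<beta>'\<in>path_class X \<beta>. path_class X (\<alpha> +++ \<beta>))"
    by (intro SUP_cong refl) auto
  moreover have "path_class X \<alpha> \<noteq> {}" "path_class X \<beta> \<noteq> {}"
    using path_class_self[OF assms(1)] path_class_self[OF assms(2)] by auto
  ultimately show ?thesis
    by (simp add: fundamental_group_def)
qed

lemma homotopic_paths_compose_unit_interval:
  assumes "path p" "path_image p \<subseteq> X"
    and "path r" "path_image r \<subseteq> {0..1}" "path s" "path_image s \<subseteq> {0..1}"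
    and "pathstart r = pathstart s" "pathfinish r = pathfinish s"
  shows "homotopic_paths X (p \<circ> r) (p \<circ> s)"
proof (rule homotopic_paths_continuous_image)
  show "homotopic_paths {0..1} r s"
  proof (rule homotopic_paths_linear)
    fix t :: real assume "t \<in> {0..1}"
    then have "r t \<in> {0..1}" "s t \<in> {0..1}"
      using assms(4,6) unfolding path_image_def by blast+
    then show "closed_segment (r t) (s t) \<subseteq> {0..1}"
      by (intro closed_segment_subset) (auto simp: convex_real_interval)
  qed (use assms in auto)
  show "continuous_on {0..1} p" "p \<in> {0..1} \<rightarrow> X"
    using assms(1,2) by (auto simp: path_def path_image_def)
qed

lemma group_fundamental_group:
  assumes "x \<in> X"
  shows "group (fundamental_group X x)"
proof (rule groupI)
  let ?G = "fundamental_group X x"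
  have carr: "carrier ?G = path_class X ` based_loops X x"
    and one: "\<one>\<^bsub>?G\<^esub> = path_class X (\<lambda>_. x)"
    by (auto simp: fundamental_group_def)
  show "\<one>\<^bsub>?G\<^esub> \<in> carrier ?G"
    using based_loops_const[OF assms] by (simp add: carr one)
  show "A \<otimes>\<^bsub>?G\<^esub> B \<in> carrier ?G" if "A \<in> carrier ?G" "B \<in> carrier ?G" for A B
    using that by (auto simp: carr fundamental_group_mult based_loops_join)
  show "A \<otimes>\<^bsub>?G\<^esub> B \<otimes>\<^bsub>?G\<^esub> C = A \<otimes>\<^bsub>?G\<^esub> (B \<otimes>\<^bsub>?G\<^esub> C)"
    if ABC: "A \<in> carrier ?G" "B \<in> carrier ?G" "C \<in> carrier ?G" for A B C
  proof -
    obtain \<alpha> \<beta> \<gamma> where l: "\<alpha> \<in> based_loops X x" "\<beta> \<in> based_loops X x" "\<gamma> \<in> based_loops X x"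
      and e: "A = path_class X \<alpha>" "B = path_class X \<beta>" "C = path_class X \<gamma>"
      using ABC unfolding carr by (elim imageE) blast
    have "homotopic_paths X (\<alpha> +++ \<beta> +++ \<gamma>) ((\<alpha> +++ \<beta>) +++ \<gamma>)"
      using l by (intro homotopic_paths_assoc) (auto simp: based_loops_def)
    then show ?thesis
      using l by (simp add: e fundamental_group_mult based_loops_join path_class_eq)
  qed
  show "\<one>\<^bsub>?G\<^esub> \<otimes>\<^bsub>?G\<^esub> A = A" if A: "A \<in> carrier ?G" for A
  proof -
    obtain \<alpha> where l: "\<alpha> \<in> based_loops X x" and e: "A = path_class X \<alpha>"
      using A by (auto simp: carr)
    have "homotopic_paths X (\<alpha> \<circ> (linepath 0 0 +++ linepath 0 1)) (\<alpha> \<circ> linepath 0 1)"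
      using l by (intro homotopic_paths_compose_unit_interval)
        (auto simp: based_loops_def path_image_join closed_segment_eq_real_ivl)
    moreover have "\<alpha> \<circ> (linepath 0 0 +++ linepath 0 1) = (\<lambda>_. x) +++ \<alpha>"
      using l by (auto simp: fun_eq_iff joinpaths_def linepath_def based_loops_def pathstart_def)
    moreover have "\<alpha> \<circ> linepath 0 1 = \<alpha>"
      by (auto simp: fun_eq_iff linepath_def)
    ultimately have "path_class X ((\<lambda>_. x) +++ \<alpha>) = path_class X \<alpha>"
      by (simp add: path_class_eq)
    then show ?thesis
      by (simp add: one e fundamental_group_mult l based_loops_const assms)
  qed
  show "\<exists>B\<in>carrier ?G. B \<otimes>\<^bsub>?G\<^esub> A = \<one>\<^bsub>?G\<^esub>" if A: "A \<in> carrier ?G" for A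
  proof -
    obtain \<alpha> where l: "\<alpha> \<in> based_loops X x" and e: "A = path_class X \<alpha>"
      using A by (auto simp: carr)
    have "homotopic_paths X (\<alpha> \<circ> (linepath 1 0 +++ linepath 0 1)) (\<alpha> \<circ> linepath 1 1)"
      using l by (intro homotopic_paths_compose_unit_interval)
        (auto simp: based_loops_def path_image_join closed_segment_eq_real_ivl)
    moreover have "\<alpha> \<circ> (linepath 1 0 +++ linepath 0 1) = reversepath \<alpha> +++ \<alpha>"
      by (auto simp: fun_eq_iff joinpaths_def linepath_def reversepath_def)
    moreover have "\<alpha> \<circ> linepath 1 1 = (\<lambda>_. x)"
      using l by (auto simp: fun_eq_iff linepath_def based_loops_def pathfinish_def)
    ultimately have "path_class X (reversepath \<alpha> +++ \<alpha>) = path_class X (\<lambda>_. x)"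
      by (simp add: path_class_eq)
    then show ?thesis
      using l based_loops_reverse[OF l]
      by (intro bexI[of _ "path_class X (reversepath \<alpha>)"])
         (auto simp: one e carr fundamental_group_mult)
  qed
qed

lemma fundamental_map_path_class:
  assumes "\<alpha> \<in> based_loops X x" "continuous_on X f" "f ` X \<subseteq> Y"
  shows "fundamental_map Y f (path_class X \<alpha>) = path_class Y (f \<circ> \<alpha>)"
proof -
  have "path_class Y (f \<circ> \<beta>) = path_class Y (f \<circ> \<alpha>)" if "\<beta> \<in> path_class X \<alpha>" for \<beta>
    using that assms
    by (intro path_class_eq homotopic_paths_sym[OF homotopic_paths_continuous_image[of X]])
       (auto simp: path_class_def)
  then have "fundamental_map Y f (path_class X \<alpha>) = (\<Union>\<beta>\<in>path_class X \<alpha>. path_class Y (f \<circ> \<alpha>))"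
    unfolding fundamental_map_def by (intro SUP_cong refl) auto
  moreover have "path_class X \<alpha> \<noteq> {}"
    using path_class_self[OF assms(1)] by auto
  ultimately show ?thesis
    by simp
qed


section \<open>Closed oriented surfaces\<close>

text \<open>The \<open>4 * g\<close> sides of the disc, counterclockwise, with the boundary word
  \<open>a b a\<^sup>- b\<^sup>-\<close> repeated \<open>g\<close> times.\<close>

definition polygon_side :: "nat \<Rightarrow> nat \<Rightarrow> real \<Rightarrow> complex" where
  "polygon_side g k t = cis (2 * pi * (real k + t) / (4 * real g))"

inductive polygon_glue :: "nat \<Rightarrow> complex \<Rightarrow> complex \<Rightarrow> bool" for g where
  glue_a: "j < g \<Longrightarrow> t \<in> {0..1} \<Longrightarrow>
    polygon_glue g (polygon_side g (4 * j) t) (polygon_side g (4 * j + 2) (1 - t))"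
| glue_b: "j < g \<Longrightarrow> t \<in> {0..1} \<Longrightarrow>
    polygon_glue g (polygon_side g (4 * j + 1) t) (polygon_side g (4 * j + 3) (1 - t))"

text \<open>For \<open>g \<ge> 1\<close>: \<open>F\<close> is the closed surface of genus \<open>g\<close>, identified by \<open>\<kappa>\<close> with the standard
  quotient of the disc; its orientation is the one induced by \<open>\<kappa>\<close> from the plane.\<close>

definition oriented_surface ::
  "nat \<Rightarrow> 'b::topological_space set \<Rightarrow> (complex \<Rightarrow> 'b) \<Rightarrow> bool" where
  "oriented_surface g F \<kappa> \<longleftrightarrow>
     quotient_map (top_of_set (cball 0 1)) (top_of_set F) \<kappa> \<and>
     (\<forall>z\<in>cball 0 1. \<forall>w\<in>cball 0 1. \<kappa> z = \<kappa> w \<longleftrightarrow> equivclp (polygon_glue g) z w)"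


section \<open>Principal circle bundles\<close>

definition principal_circle_bundle ::
  "'p::topological_space set \<Rightarrow> ('p \<Rightarrow> 'b::topological_space) \<Rightarrow> 'b set \<Rightarrow>
     ('p \<Rightarrow> complex \<Rightarrow> 'p) \<Rightarrow> bool" where
  "principal_circle_bundle P p F act \<longleftrightarrow>
     continuous_on P p \<and> p ` P = F \<and>
     continuous_on (P \<times> sphere 0 1) (\<lambda>(x, z). act x z) \<and>
     (\<forall>x\<in>P. \<forall>z\<in>sphere 0 1. act x z \<in> P \<and> p (act x z) = p x) \<and>
     (\<forall>x\<in>P. act x 1 = x) \<and>
     (\<forall>x\<in>P. \<forall>z\<in>sphere 0 1. \<forall>w\<in>sphere 0 1. act (act x z) w = act x (z * w)) \<and>
     (\<forall>b\<in>F. \<exists>U h k. b \<in> U \<and> openin (top_of_set F) U \<and>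
        homeomorphism (U \<times> sphere 0 1) (P \<inter> p -` U) h k \<and>
        (\<forall>y\<in>U. \<forall>z\<in>sphere 0 1. p (h (y, z)) = y \<and>
           (\<forall>w\<in>sphere 0 1. h (y, z * w) = act (h (y, z)) w)))"

text \<open>The Chern class as the obstruction to a section, evaluated on the fundamental class of the
  base: \<open>K\<close> trivializes the bundle over the 2-cell, \<open>s\<close> is a section over the 1-skeleton, and \<open>h\<close>
  is \<open>s\<close> read in the trivialization \<open>K\<close> along the boundary of the 2-cell.\<close>

definition has_chern_number ::
  "(complex \<Rightarrow> 'b::topological_space) \<Rightarrow> 'p::topological_space set \<Rightarrow> ('p \<Rightarrow> 'b) \<Rightarrow>
     ('p \<Rightarrow> complex \<Rightarrow> 'p) \<Rightarrow> int \<Rightarrow> bool" where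
  "has_chern_number \<kappa> P p act c \<longleftrightarrow>
     (\<exists>K s h.
        continuous_on (cball 0 1) K \<and> K ` cball 0 1 \<subseteq> P \<and> (\<forall>z\<in>cball 0 1. p (K z) = \<kappa> z) \<and>
        continuous_on (\<kappa> ` sphere 0 1) s \<and> s ` \<kappa> ` sphere 0 1 \<subseteq> P \<and>
        (\<forall>y\<in>\<kappa> ` sphere 0 1. p (s y) = y) \<and>
        continuous_on (sphere 0 1) h \<and> h ` sphere 0 1 \<subseteq> sphere 0 1 \<and>
        (\<forall>z\<in>sphere 0 1. s (\<kappa> z) = act (K z) (h z)) \<and>
        winding_number (h \<circ> circlepath 0 1) 0 = of_int c)"

definition circle_generator :: "(real \<Rightarrow> complex) set \<Rightarrow> bool" where
  "circle_generator \<omega> \<longleftrightarrow>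
     \<omega> \<in> carrier (fundamental_group (sphere 0 1) 1) \<and>
     generate (fundamental_group (sphere 0 1) 1) {\<omega>} = carrier (fundamental_group (sphere 0 1) 1)"

definition fiber_class ::
  "'p::topological_space set \<Rightarrow> ('p \<Rightarrow> complex \<Rightarrow> 'p) \<Rightarrow> 'p \<Rightarrow> (real \<Rightarrow> complex) set \<Rightarrow>
     (real \<Rightarrow> 'p) set" where
  "fiber_class P act x \<omega> = fundamental_map P (act x) \<omega>"


section \<open>Special double coverings\<close>

text \<open>The monodromy sends the class of a loop to 0 or 1 according to whether the permutation of the
  two-point fibre over \<open>x\<close> obtained by lifting the loop is trivial; every loop at \<open>x\<close> is of the
  form \<open>q \<circ> \<eta>\<close> on the unit interval. In particular the kernel of \<open>\<phi>\<close> is the image of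
  the fundamental group of \<open>E\<close>.\<close>

definition double_covering ::
  "'e::topological_space set \<Rightarrow> ('e \<Rightarrow> 'p::topological_space) \<Rightarrow> 'p set \<Rightarrow> 'p \<Rightarrow>
     ((real \<Rightarrow> 'p) set \<Rightarrow> int) \<Rightarrow> bool" where
  "double_covering E q P x \<phi> \<longleftrightarrow>
     covering_space E q P \<and> (\<forall>y\<in>P. card {e \<in> E. q e = y} = 2) \<and>
     \<phi> \<in> hom (fundamental_group P x) (integer_mod_group 2) \<and>
     (\<forall>\<eta>. path \<eta> \<and> path_image \<eta> \<subseteq> E \<and> q (pathstart \<eta>) = x \<and> q (pathfinish \<eta>) = x \<longrightarrow>
        (\<phi> (path_class P (q \<circ> \<eta>)) = 0 \<longleftrightarrow> pathfinish \<eta> = pathstart \<eta>))"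

definition special_double_covering ::
  "'e::topological_space set \<Rightarrow> ('e \<Rightarrow> 'p::topological_space) \<Rightarrow> 'p set \<Rightarrow> 'p \<Rightarrow>
     (real \<Rightarrow> 'p) set \<Rightarrow> ((real \<Rightarrow> 'p) set \<Rightarrow> int) \<Rightarrow> bool" where
  "special_double_covering E q P x u\<^sub>0 \<phi> \<longleftrightarrow> double_covering E q P x \<phi> \<and> \<phi> u\<^sub>0 = 1"

definition weakly_equivalent ::
  "('a, 'm) monoid_scheme \<Rightarrow> ('a \<Rightarrow> int) \<Rightarrow> ('a \<Rightarrow> int) \<Rightarrow> bool" where
  "weakly_equivalent G \<phi> \<phi>' \<longleftrightarrow> (\<exists>f\<in>iso G G. \<forall>\<gamma>\<in>carrier G. \<phi> \<gamma> = \<phi>' (f \<gamma>))"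

end

theory Submission
  imports Defs
begin

text \<open>
  Let \<open>D\<close> be the closed disc whose quotient under \<open>\<kappa>\<close> is \<open>F\<close>. The automorphism of the fundamental
  group is induced by a gauge transformation of the bundle: a continuous \<open>f\<close> from \<open>F\<close> to the unit
  circle gives the homeomorphism \<open>R y = act y (f (p y))\<close> of \<open>P\<close>, which fixes \<open>x\<^sub>0\<close> if \<open>f (p x\<^sub>0) = 1\<close>.
  If \<open>R\<close> is covered by a map \<open>\<Psi>\<close> from \<open>E\<close> to \<open>E'\<close> that is injective on fibres, then a loop lifts to a
  closed path in \<open>E\<close> exactly when its image under \<open>R\<close> lifts to a closed path in \<open>E'\<close>. This says
  that \<open>\<phi>\<close> is \<open>\<phi>'\<close> composed with the map induced by \<open>R\<close> (\<open>monodromy_pullback\<close>), so everything comes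
  down to a good choice of \<open>f\<close>.

  A section \<open>K\<close> over the disc yields \<open>unwrap (z, t) = act (K z) (cis (2 * pi * t))\<close>, which presents \<open>P\<close>
  as a quotient of the contractible space \<open>D \<times> \<real>\<close> (\<open>unwrap_quotient\<close>). Let \<open>L\<close> and \<open>M\<close> be lifts of
  this map to \<open>E\<close> and \<open>E'\<close>. That the coverings are special means that one turn around a
  circle fibre of \<open>P\<close> exchanges the two points over its end, that is, \<open>L (z, t + 1) \<noteq> L (z, t)\<close>
  (\<open>special_double_covering_lift\<close>). So \<open>L\<close> reaches both points over every point of \<open>P\<close>, has
  period exactly 2 in \<open>t\<close>, and presents \<open>E\<close> as a quotient of \<open>D \<times> \<real>\<close> (\<open>double_lift_quotient\<close>); the
  same holds for \<open>M\<close> and \<open>E'\<close>.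

  If \<open>z\<close> and \<open>w\<close> are corresponding points on two identified sides, then \<open>L (z, t) = L (w, c + t)\<close> for some \<open>c\<close>
  and \<open>M (z, t) = M (w, c + n + t)\<close> for an integer \<open>n\<close>, which by uniqueness of lifts can be taken
  constant along each pair of identified sides (\<open>lifts_differ_by_jumps\<close>). The parities of these
  \<open>2 * g\<close> integers are the difference of \<open>\<phi>\<close> and \<open>\<phi>'\<close>, a class in the first cohomology of \<open>F\<close> modulo 2.
  This class is the reduction of an integral one: there is a continuous real function \<open>m\<close> on \<open>D\<close> that
  jumps by exactly \<open>n\<close> across each pair of identified sides (\<open>prescribed_jumps\<close>). Then \<open>cis (2 * pi * m)\<close>
  descends to the wanted \<open>f\<close>, the map \<open>(z, t) \<mapsto> M (z, t + m z)\<close> is a lift of \<open>R\<close> after \<open>unwrap\<close>, and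
  it respects all identifications made by \<open>L\<close>, so that it descends to \<open>\<Psi>\<close> (\<open>double_lift_map\<close>).
\<close>

section \<open>Lifting through covering maps of topological spaces\<close>

lemma continuous_on_locally_openin:
  assumes "\<And>x. x \<in> S \<Longrightarrow> \<exists>U. openin (top_of_set S) U \<and> x \<in> U \<and> continuous_on U f"
  shows "continuous_on S f"
  unfolding continuous_on_def
proof
  fix x assume x: "x \<in> S"
  obtain U T where U: "x \<in> U" "continuous_on U f" "open T" "U = S \<inter> T"
    using assms[OF x] by (auto simp: openin_open)
  then have "(f \<longlongrightarrow> f x) (at x within U)"
    by (auto simp: continuous_on_def)
  moreover have "at x within U = at x within S"
    using U by (intro at_within_nhd[of x T]) auto
  ultimately show "(f \<longlongrightarrow> f x) (at x within S)" by simp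
qed

lemma covering_space_evenly_covered:
  assumes "covering_space E q P" "y \<in> P"
  obtains V where "y \<in> V" "openin (top_of_set P) V"
    "\<And>e. e \<in> E \<Longrightarrow> q e \<in> V \<Longrightarrow>
       \<exists>T \<sigma>. e \<in> T \<and> openin (top_of_set E) T \<and> homeomorphism T V q \<sigma>"
proof -
  obtain V v where V: "y \<in> V" "openin (top_of_set P) V" "\<Union>v = E \<inter> q -` V"
    "\<forall>u\<in>v. openin (top_of_set E) u" "\<forall>u\<in>v. \<exists>\<sigma>. homeomorphism u V q \<sigma>"
    using assms unfolding covering_space_def by metis
  have "\<exists>T \<sigma>. e \<in> T \<and> openin (top_of_set E) T \<and> homeomorphism T V q \<sigma>"
    if "e \<in> E" "q e \<in> V" for e
  proof -
    have "e \<in> \<Union>v" using that V(3) by auto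
    then show ?thesis using V(4,5) by blast
  qed
  with V(1,2) show ?thesis by (rule that)
qed

text \<open>
  Two points of one fibre lie in different sheets over an evenly covered set, because the covering map is
  injective on a sheet. This replaces a separation axiom on the total space.
\<close>

lemma covering_space_separates_fibre:
  assumes "covering_space E q P" "e \<in> E" "e' \<in> E" "q e = q e'" "e \<noteq> e'"
  obtains T T' where "e \<in> T" "e' \<in> T'" "T \<inter> T' = {}"
    "openin (top_of_set E) T" "openin (top_of_set E) T'"
proof -
  have "q e \<in> P" using assms(1,2) by (auto simp: covering_space_def)
  then obtain V v where V: "q e \<in> V" "\<Union>v = E \<inter> q -` V"
    "\<forall>u\<in>v. openin (top_of_set E) u" "pairwise disjnt v" "\<forall>u\<in>v. \<exists>\<sigma>. homeomorphism u V q \<sigma>"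
    using assms(1) unfolding covering_space_def by metis
  have "e \<in> \<Union>v" "e' \<in> \<Union>v" using assms V(1,2) by auto
  then obtain T T' where T: "T \<in> v" "T' \<in> v" "e \<in> T" "e' \<in> T'" by blast
  have "T \<noteq> T'"
  proof
    assume "T = T'"
    obtain \<sigma> where "homeomorphism T V q \<sigma>" using V(5) T(1) by blast
    then have "e = e'" using T \<open>T = T'\<close> assms(4) unfolding homeomorphism_def by metis
    with assms(5) show False by simp
  qed
  then have "T \<inter> T' = {}" using V(4) T by (auto simp: pairwise_def disjnt_def)
  with that T V(3) show ?thesis by blast
qed

text \<open>
  The set where two lifts agree is open because the covering map is locally injective, and its
  complement is open because points of one fibre can be separated.
\<close>

lemma covering_space_lifts_agree:
  assumes cov: "covering_space E q P" and "connected S"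
    and g: "continuous_on S g" "g ` S \<subseteq> E" and h: "continuous_on S h" "h ` S \<subseteq> E"
    and eq: "\<And>x. x \<in> S \<Longrightarrow> q (g x) = q (h x)"
    and a: "a \<in> S" "g a = h a" and "x \<in> S"
  shows "g x = h x"
proof -
  have pre: "openin (top_of_set S) (S \<inter> g -` T)" "openin (top_of_set S) (S \<inter> h -` T)"
    if "openin (top_of_set E) T" for T
    using that g h by (auto intro!: continuous_openin_preimage[where T=E])
  have op: "openin (top_of_set S) {x \<in> S. g x = h x}"
  proof (subst openin_subopen, safe)
    fix x assume x: "x \<in> S" "g x = h x"
    then have "g x \<in> E" using g by auto
    then obtain T V \<sigma> where T: "g x \<in> T" "openin (top_of_set E) T" "homeomorphism T V q \<sigma>"
      by (rule covering_space_local_homeomorphism[OF cov])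
    have "S \<inter> g -` T \<inter> (S \<inter> h -` T) \<subseteq> {x \<in> S. g x = h x}"
    proof safe
      fix y assume y: "y \<in> S" "g y \<in> T" "h y \<in> T"
      then have "\<sigma> (q (g y)) = g y" "\<sigma> (q (h y)) = h y"
        using T(3) by (auto simp: homeomorphism_def)
      with eq[OF y(1)] show "g y = h y" by metis
    qed
    then show "\<exists>W. openin (top_of_set S) W \<and> x \<in> W \<and> W \<subseteq> {x \<in> S. g x = h x}"
    proof (intro exI conjI)
      show "openin (top_of_set S) (S \<inter> g -` T \<inter> (S \<inter> h -` T))"
        using pre[OF T(2)] by blast
      show "x \<in> S \<inter> g -` T \<inter> (S \<inter> h -` T)" using T(1) x by simp
    qed
  qed
  have cl: "openin (top_of_set S) {x \<in> S. g x \<noteq> h x}"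
  proof (subst openin_subopen, safe)
    fix x assume x: "x \<in> S" "g x \<noteq> h x"
    have "g x \<in> E" "h x \<in> E" using g h x by auto
    from covering_space_separates_fibre[OF cov this eq[OF x(1)] x(2)]
    obtain T T' where T: "g x \<in> T" "h x \<in> T'" "T \<inter> T' = {}"
      "openin (top_of_set E) T" "openin (top_of_set E) T'" .
    show "\<exists>W. openin (top_of_set S) W \<and> x \<in> W \<and> W \<subseteq> {x \<in> S. g x \<noteq> h x}"
    proof (intro exI conjI)
      show "openin (top_of_set S) (S \<inter> g -` T \<inter> (S \<inter> h -` T'))"
        using pre(1)[OF T(4)] pre(2)[OF T(5)] by blast
      show "x \<in> S \<inter> g -` T \<inter> (S \<inter> h -` T')" using T(1,2) x by simp
      show "S \<inter> g -` T \<inter> (S \<inter> h -` T') \<subseteq> {x \<in> S. g x \<noteq> h x}" using T(3) by force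
    qed
  qed
  have "{x \<in> S. g x \<noteq> h x} = {}"
  proof (rule ccontr)
    assume "{x \<in> S. g x \<noteq> h x} \<noteq> {}"
    moreover have "S \<subseteq> {x \<in> S. g x = h x} \<union> {x \<in> S. g x \<noteq> h x}" by auto
    moreover have "{x \<in> S. g x = h x} \<inter> {x \<in> S. g x \<noteq> h x} = {}" by auto
    moreover have "{x \<in> S. g x = h x} \<noteq> {}" using a by auto
    ultimately show False
      using \<open>connected S\<close> op cl unfolding connected_openin by blast
  qed
  then show ?thesis using \<open>x \<in> S\<close> by auto
qed

lemma continuous_on_paste_intervals:
  fixes a b c :: real
  assumes "a \<le> b" "b \<le> c" "continuous_on (N \<times> {a..b}) G" "continuous_on (N \<times> {b..c}) G"
  shows "continuous_on (N \<times> {a..c}) G"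
proof -
  have eq: "N \<times> {a..c} = N \<times> {a..b} \<union> N \<times> {b..c}" using assms by auto
  have "closedin (top_of_set (N \<times> {a..c})) (N \<times> {a..b})"
    by (rule closedin_Times) (use assms in \<open>auto simp: closedin_closed_eq\<close>)
  moreover have "closedin (top_of_set (N \<times> {a..c})) (N \<times> {b..c})"
    by (rule closedin_Times) (use assms in \<open>auto simp: closedin_closed_eq\<close>)
  ultimately show ?thesis
    using assms(3,4) unfolding eq by (intro continuous_on_Un_local) auto
qed

text \<open>
  Liftability with prescribed initial point passes from two adjacent intervals to their union, and holds
  on short intervals, whose image lies in an evenly covered set. The principle of Bolzano concludes.
\<close>

lemma covering_space_path_lift:
  fixes f :: "real \<Rightarrow> 'p::topological_space" and q :: "'e::topological_space \<Rightarrow> 'p"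
  assumes cov: "covering_space E q P" and "a \<le> b"
    and f: "continuous_on {a..b} f" "f ` {a..b} \<subseteq> P" and "e \<in> E" "q e = f a"
  shows "\<exists>g. continuous_on {a..b} g \<and> g ` {a..b} \<subseteq> E \<and> g a = e \<and> (\<forall>t\<in>{a..b}. q (g t) = f t)"
proof -
  define Q where "Q c d \<longleftrightarrow> (a \<le> c \<and> d \<le> b \<longrightarrow> (\<forall>e\<in>E. q e = f c \<longrightarrow>
     (\<exists>g. continuous_on {c..d} g \<and> g ` {c..d} \<subseteq> E \<and> g c = e \<and> (\<forall>t\<in>{c..d}. q (g t) = f t))))"
    for c d
  have "Q a b" using \<open>a \<le> b\<close>
  proof (induction rule: Bolzano)
    case (trans a' b' c')
    show ?case unfolding Q_def
    proof (intro impI ballI)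
      fix e assume ab: "a \<le> a' \<and> c' \<le> b" and e: "e \<in> E" "q e = f a'"
      obtain g where g: "continuous_on {a'..b'} g" "g ` {a'..b'} \<subseteq> E" "g a' = e"
        "\<forall>t\<in>{a'..b'}. q (g t) = f t"
        using trans ab e unfolding Q_def by force
      have "g b' \<in> E" "q (g b') = f b'" using g trans by auto
      then obtain h where h: "continuous_on {b'..c'} h" "h ` {b'..c'} \<subseteq> E" "h b' = g b'"
        "\<forall>t\<in>{b'..c'}. q (h t) = f t"
        using trans ab unfolding Q_def by force
      define k where "k t = (if t \<le> b' then g t else h t)" for t
      have eq: "{a'..c'} = {a'..b'} \<union> {b'..c'}" using trans by auto
      have "continuous_on {a'..c'} k"
        unfolding k_def eq
        by (rule continuous_on_cases_local)
           (use trans g h in \<open>auto simp: closedin_closed_eq eq[symmetric]\<close>)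
      then show "\<exists>g. continuous_on {a'..c'} g \<and> g ` {a'..c'} \<subseteq> E \<and> g a' = e \<and>
          (\<forall>t\<in>{a'..c'}. q (g t) = f t)"
        using g h trans by (intro exI[of _ k]) (auto simp: k_def image_subset_iff)
    qed
  next
    case (local x)
    then have "f x \<in> P" using f by auto
    then obtain V where V: "f x \<in> V" "openin (top_of_set P) V"
      "\<And>e. e \<in> E \<Longrightarrow> q e \<in> V \<Longrightarrow>
       \<exists>T \<sigma>. e \<in> T \<and> openin (top_of_set E) T \<and> homeomorphism T V q \<sigma>"
      by (rule covering_space_evenly_covered[OF cov]) blast
    have "openin (top_of_set {a..b}) ({a..b} \<inter> f -` V)"
      using f V by (auto intro!: continuous_openin_preimage[where T=P])
    then obtain W where W: "open W" "{a..b} \<inter> f -` V = {a..b} \<inter> W"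
      by (auto simp: openin_open)
    have "x \<in> {a..b} \<inter> f -` V" using V(1) local by auto
    then have "x \<in> W" using W(2) by blast
    then obtain d where "d > 0" "\<And>y. dist y x < d \<Longrightarrow> y \<in> W"
      using W(1) unfolding open_dist by blast
    then have d: "d > 0" "\<And>y. y \<in> {a..b} \<Longrightarrow> dist y x < d \<Longrightarrow> f y \<in> V"
      using W(2) by blast+
    show ?case
    proof (intro exI[of _ d] conjI allI impI d(1))
      fix c c' assume c: "c \<le> x \<and> x \<le> c' \<and> c' - c < d"
      show "Q c c'" unfolding Q_def
      proof (intro impI ballI)
        fix e assume cc: "a \<le> c \<and> c' \<le> b" and e: "e \<in> E" "q e = f c"
        have fV: "f t \<in> V" if "t \<in> {c..c'}" for t
          using that c cc by (intro d(2)) (auto simp: dist_real_def)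
        have "q e \<in> V" using fV[of c] c e by auto
        from V(3)[OF e(1) this] obtain T \<sigma> where T: "e \<in> T" "openin (top_of_set E) T"
          "homeomorphism T V q \<sigma>" by blast
        have "T \<subseteq> E" using T(2) by (simp add: openin_imp_subset)
        have "continuous_on {c..c'} (\<lambda>t. \<sigma> (f t))"
          by (rule continuous_on_compose2[of V \<sigma>])
             (use T f cc fV in \<open>auto simp: homeomorphism_def intro: continuous_on_subset\<close>)
        moreover have "\<sigma> (f c) = e" using T e by (auto simp: homeomorphism_def)
        moreover have "\<sigma> (f t) \<in> E" "q (\<sigma> (f t)) = f t" if "t \<in> {c..c'}" for t
          using T fV[OF that] \<open>T \<subseteq> E\<close> by (auto simp: homeomorphism_def)
        ultimately show "\<exists>g. continuous_on {c..c'} g \<and> g ` {c..c'} \<subseteq> E \<and> g c = e \<and>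
            (\<forall>t\<in>{c..c'}. q (g t) = f t)"
          by (intro exI[of _ "\<lambda>t. \<sigma> (f t)"]) auto
      qed
    qed
  qed
  then show ?thesis using assms unfolding Q_def by auto
qed

text \<open>
  The paths \<open>t \<mapsto> f (z, t)\<close> are lifted one by one; what needs proof is that these lifts depend
  continuously on \<open>z\<close>. Near a fixed \<open>z\<close>, continuity at time \<open>a\<close> propagates to a whole interval \<open>{a..b}\<close>:
  for short intervals the lifts of all nearby paths stay in one sheet, and longer ones follow by
  the principle of Bolzano. The neighbourhood of \<open>z\<close> may shrink at each of the finitely many steps.
\<close>

lemma covering_space_homotopy_lift:
  fixes f :: "'c::topological_space \<times> real \<Rightarrow> 'p::topological_space"
    and q :: "'e::topological_space \<Rightarrow> 'p"
  assumes cov: "covering_space E q P"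
    and f: "continuous_on (S \<times> {0..1}) f" "f ` (S \<times> {0..1}) \<subseteq> P"
    and g0: "continuous_on S g0" "g0 ` S \<subseteq> E" "\<And>z. z \<in> S \<Longrightarrow> q (g0 z) = f (z, 0)"
  obtains G where "continuous_on (S \<times> {0..1}) G" "G ` (S \<times> {0..1}) \<subseteq> E"
    "\<And>z. z \<in> S \<Longrightarrow> G (z, 0) = g0 z"
    "\<And>z t. z \<in> S \<Longrightarrow> t \<in> {0..1} \<Longrightarrow> q (G (z, t)) = f (z, t)"
proof -
  have fz: "continuous_on {0..1} (\<lambda>t. f (z, t))" if "z \<in> S" for z
    by (rule continuous_on_compose2[OF f(1)]) (use that in \<open>auto intro!: continuous_intros\<close>)
  have "\<forall>z\<in>S. \<exists>g. continuous_on {0..1} g \<and> g ` {0..1} \<subseteq> E \<and> g 0 = g0 z \<and>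
      (\<forall>t\<in>{0..1}. q (g t) = f (z, t))"
  proof
    fix z assume z: "z \<in> S"
    show "\<exists>g. continuous_on {0..1} g \<and> g ` {0..1} \<subseteq> E \<and> g 0 = g0 z \<and>
      (\<forall>t\<in>{0..1}. q (g t) = f (z, t))"
      by (rule covering_space_path_lift[OF cov _ fz[OF z]]) (use f(2) g0(2,3) z in auto)
  qed
  then obtain \<gamma> where \<gamma>: "\<And>z. z \<in> S \<Longrightarrow> continuous_on {0..1} (\<gamma> z)"
    "\<And>z t. z \<in> S \<Longrightarrow> t \<in> {0..1} \<Longrightarrow> \<gamma> z t \<in> E" "\<And>z. z \<in> S \<Longrightarrow> \<gamma> z 0 = g0 z"
    "\<And>z t. z \<in> S \<Longrightarrow> t \<in> {0..1} \<Longrightarrow> q (\<gamma> z t) = f (z, t)"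
    unfolding bchoice_iff image_subset_iff by blast
  define G where "G = (\<lambda>(z, t). \<gamma> z t)"
  have loc: "\<exists>N. openin (top_of_set S) N \<and> z \<in> N \<and> continuous_on (N \<times> {0..1}) G"
    if z: "z \<in> S" for z
  proof -
    define Q where "Q a b \<longleftrightarrow> (0 \<le> a \<and> b \<le> 1 \<longrightarrow>
      (\<forall>N. openin (top_of_set S) N \<and> z \<in> N \<and> continuous_on N (\<lambda>w. \<gamma> w a) \<longrightarrow>
        (\<exists>M. openin (top_of_set S) M \<and> z \<in> M \<and> continuous_on (M \<times> {a..b}) G)))" for a b
    have "Q 0 1" using zero_le_one
    proof (induction rule: Bolzano)
      case (trans a b c)
      show ?case unfolding Q_def
      proof (intro impI allI)
        fix N assume ac: "0 \<le> a \<and> c \<le> 1"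
          and N: "openin (top_of_set S) N \<and> z \<in> N \<and> continuous_on N (\<lambda>w. \<gamma> w a)"
        obtain M where M: "openin (top_of_set S) M" "z \<in> M" "continuous_on (M \<times> {a..b}) G"
          using trans ac N unfolding Q_def by force
        have "continuous_on M (\<lambda>w. G (w, b))"
          by (rule continuous_on_compose2[OF M(3)])
             (use trans in \<open>auto intro!: continuous_intros\<close>)
        then obtain M' where M': "openin (top_of_set S) M'" "z \<in> M'"
          "continuous_on (M' \<times> {b..c}) G"
          using trans ac M unfolding Q_def G_def by force
        have "continuous_on ((M \<inter> M') \<times> {a..c}) G"
          using trans(3,4) by (rule continuous_on_paste_intervals)
             (auto intro: continuous_on_subset[OF M(3)] continuous_on_subset[OF M'(3)])
        then show "\<exists>M. openin (top_of_set S) M \<and> z \<in> M \<and> continuous_on (M \<times> {a..c}) G"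
          using M M' by (intro exI[of _ "M \<inter> M'"]) auto
      qed
    next
      case (local t)
      then have zt: "(z, t) \<in> S \<times> {0..1}" using z by auto
      then have "f (z, t) \<in> P" using f by auto
      then obtain V where V: "f (z, t) \<in> V" "openin (top_of_set P) V"
        "\<And>e. e \<in> E \<Longrightarrow> q e \<in> V \<Longrightarrow>
         \<exists>T \<sigma>. e \<in> T \<and> openin (top_of_set E) T \<and> homeomorphism T V q \<sigma>"
        by (rule covering_space_evenly_covered[OF cov]) blast
      have "openin (top_of_set (S \<times> {0..1})) (S \<times> {0..1} \<inter> f -` V)"
        using f V by (auto intro!: continuous_openin_preimage[where T=P])
      then obtain W where W: "open W" "S \<times> {0..1} \<inter> f -` V = S \<times> {0..1} \<inter> W"
        by (auto simp: openin_open)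
      have "(z, t) \<in> S \<times> {0..1} \<inter> f -` V" using V(1) zt by auto
      then have "(z, t) \<in> W" using W(2) by blast
      then obtain A B where AB: "open A" "open B" "z \<in> A" "t \<in> B" "A \<times> B \<subseteq> W"
        using open_prod_elim[OF W(1)] by (metis mem_Sigma_iff)
      obtain d where d: "d > 0" "\<And>s. dist s t < d \<Longrightarrow> s \<in> B"
        using AB(2,4) unfolding open_dist by blast
      show ?case
      proof (intro exI[of _ d] conjI allI impI d(1))
        fix a b assume ab: "a \<le> t \<and> t \<le> b \<and> b - a < d"
        show "Q a b" unfolding Q_def
        proof (intro impI allI)
          fix N assume ab1: "0 \<le> a \<and> b \<le> 1"
            and "openin (top_of_set S) N \<and> z \<in> N \<and> continuous_on N (\<lambda>w. \<gamma> w a)"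
          then have N: "openin (top_of_set S) N" "z \<in> N" "continuous_on N (\<lambda>w. \<gamma> w a)" by auto
          have NS: "N \<subseteq> S" using N(1) by (rule openin_imp_subset)
          have fV: "f (w, s) \<in> V" if "w \<in> S \<inter> A" "s \<in> {a..b}" for w s
          proof -
            have "s \<in> B" using that ab by (intro d(2)) (auto simp: dist_real_def)
            then have "(w, s) \<in> S \<times> {0..1} \<inter> W" using that AB(5) ab1 by auto
            then show ?thesis using W(2) by blast
          qed
          have "\<gamma> z a \<in> E" "q (\<gamma> z a) \<in> V"
            using \<gamma>(2,4)[OF z, of a] fV[of z a] z AB(3) ab ab1 by auto
          from V(3)[OF this] obtain T \<sigma> where T: "\<gamma> z a \<in> T" "openin (top_of_set E) T"
            "homeomorphism T V q \<sigma>" by blast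
          have \<sigma>: "\<And>y. y \<in> V \<Longrightarrow> \<sigma> y \<in> E" "\<And>y. y \<in> V \<Longrightarrow> q (\<sigma> y) = y"
            "\<And>e. e \<in> T \<Longrightarrow> \<sigma> (q e) = e" "continuous_on V \<sigma>"
            using T(3) openin_imp_subset[OF T(2)] unfolding homeomorphism_def by blast+
          define M where "M = N \<inter> (\<lambda>w. \<gamma> w a) -` T \<inter> A"
          have "openin (top_of_set N) (N \<inter> (\<lambda>w. \<gamma> w a) -` T)"
            using N(3) T(2) \<gamma>(2) NS ab ab1 by (auto intro!: continuous_openin_preimage[where T=E])
          then have M: "openin (top_of_set S) M" "z \<in> M"
            using N AB T unfolding M_def by (auto intro: openin_trans openin_Int_open)
          have MS: "M \<subseteq> S \<inter> A" "M \<subseteq> S" using NS by (auto simp: M_def)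
          have "G ws = \<sigma> (f ws)" if "ws \<in> M \<times> {a..b}" for ws
          proof -
            obtain w s where [simp]: "ws = (w, s)" by (cases ws)
            have w: "w \<in> M" "w \<in> S" "s \<in> {a..b}" using that MS by auto
            have wA: "w \<in> S \<inter> A" using w(1) MS(1) by blast
            have c1: "continuous_on {a..b} (\<gamma> w)"
              using \<gamma>(1)[OF w(2)] ab1 by (auto intro: continuous_on_subset)
            have c2: "continuous_on {a..b} (\<lambda>s. \<sigma> (f (w, s)))"
            proof (rule continuous_on_compose2[of V \<sigma>])
              show "continuous_on V \<sigma>" by fact
              show "continuous_on {a..b} (\<lambda>s. f (w, s))"
                using fz[OF w(2)] ab1 by (auto intro: continuous_on_subset)
            qed (use fV[OF wA] in auto)
            have "\<gamma> w s = \<sigma> (f (w, s))"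
            proof (rule covering_space_lifts_agree[OF cov, of "{a..b}" _ _ a])
              show "\<gamma> w ` {a..b} \<subseteq> E" using \<gamma>(2) w ab1 by auto
              show "(\<lambda>s. \<sigma> (f (w, s))) ` {a..b} \<subseteq> E"
                using fV[OF wA] by (auto intro!: \<sigma>(1))
              show "q (\<gamma> w x) = q (\<sigma> (f (w, x)))" if "x \<in> {a..b}" for x
              proof -
                have "q (\<sigma> (f (w, x))) = f (w, x)"
                  using fV[OF wA that] by (intro \<sigma>(2)) auto
                moreover have "q (\<gamma> w x) = f (w, x)"
                  using that ab1 by (intro \<gamma>(4)[OF w(2)]) auto
                ultimately show ?thesis by simp
              qed
              have "\<gamma> w a \<in> T" using w by (simp add: M_def)
              moreover have "q (\<gamma> w a) = f (w, a)" using \<gamma>(4)[OF w(2), of a] ab ab1 by auto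
              ultimately show "\<gamma> w a = \<sigma> (f (w, a))"
                using \<sigma>(3) by metis
            qed (use c1 c2 w ab in auto)
            then show ?thesis by (simp add: G_def)
          qed
          moreover have "continuous_on (M \<times> {a..b}) (\<lambda>ws. \<sigma> (f ws))"
          proof (rule continuous_on_compose2[of V \<sigma>])
            show "continuous_on V \<sigma>" by fact
            show "continuous_on (M \<times> {a..b}) f"
              by (rule continuous_on_subset[OF f(1)]) (use MS ab1 in auto)
          qed (use MS in \<open>auto intro!: fV\<close>)
          ultimately have "continuous_on (M \<times> {a..b}) G"
            using continuous_on_eq by metis
          then show "\<exists>M. openin (top_of_set S) M \<and> z \<in> M \<and> continuous_on (M \<times> {a..b}) G"
            using M by blast
        qed
      qed
    qed
    moreover have "continuous_on S (\<lambda>w. \<gamma> w 0)"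
      by (rule continuous_on_eq[OF g0(1)]) (simp add: \<gamma>(3))
    ultimately show ?thesis
      unfolding Q_def using z by (metis openin_subtopology_self order_refl)
  qed
  have "continuous_on (S \<times> {0..1}) G"
  proof (intro continuous_on_locally_openin)
    fix ws assume "ws \<in> S \<times> {0..1::real}"
    then obtain w s where [simp]: "ws = (w, s)" and w: "w \<in> S" "s \<in> {0..1}" by auto
    obtain N where "openin (top_of_set S) N" "w \<in> N" "continuous_on (N \<times> {0..1}) G"
      using loc[OF w(1)] by blast
    then show "\<exists>U. openin (top_of_set (S \<times> {0..1})) U \<and> ws \<in> U \<and> continuous_on U G"
      using w by (intro exI[of _ "N \<times> {0..1}"]) (auto intro: openin_Times)
  qed
  then show ?thesis
    using that[of G] \<gamma> by (auto simp: G_def image_subset_iff)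
qed

text \<open>
  Radial contraction of the domain is a homotopy from a constant map to \<open>f\<close>, and the constant map lifts.
\<close>

lemma covering_space_lift_starlike:
  fixes f :: "'c::real_normed_vector \<Rightarrow> 'p::topological_space"
    and q :: "'e::topological_space \<Rightarrow> 'p"
  assumes cov: "covering_space E q P"
    and S: "a \<in> S" "\<And>z. z \<in> S \<Longrightarrow> closed_segment a z \<subseteq> S"
    and f: "continuous_on S f" "f ` S \<subseteq> P"
  obtains G where "continuous_on S G" "G ` S \<subseteq> E" "\<And>z. z \<in> S \<Longrightarrow> q (G z) = f z"
proof -
  have "f a \<in> P" using f S by auto
  then obtain e where e: "e \<in> E" "q e = f a"
    using covering_space_imp_surjective[OF cov] by force
  define h where "h = (\<lambda>(z, t::real). a + t *\<^sub>R (z - a))"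
  have hS: "h (z, t) \<in> S" if "z \<in> S" "t \<in> {0..1}" for z t
  proof -
    have "h (z, t) \<in> closed_segment a z"
      using that unfolding closed_segment_def h_def by (auto intro!: exI[of _ t] simp: algebra_simps)
    then show ?thesis using S(2) that by blast
  qed
  have "continuous_on (S \<times> {0..1}) (\<lambda>x. f (h x))"
    by (rule continuous_on_compose2[OF f(1)])
       (use hS in \<open>auto simp: h_def split_def intro!: continuous_intros\<close>)
  moreover have "(\<lambda>x. f (h x)) ` (S \<times> {0..1}) \<subseteq> P" using hS f by auto
  ultimately obtain G where G: "continuous_on (S \<times> {0..1}) G" "G ` (S \<times> {0..1}) \<subseteq> E"
    "\<And>z. z \<in> S \<Longrightarrow> G (z, 0) = e"
    "\<And>z t. z \<in> S \<Longrightarrow> t \<in> {0..1} \<Longrightarrow> q (G (z, t)) = f (h (z, t))"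
    using covering_space_homotopy_lift[OF cov, of S "\<lambda>x. f (h x)" "\<lambda>_. e"] e S
    by (auto simp: h_def)
  show ?thesis
  proof
    show "continuous_on S (\<lambda>z. G (z, 1))"
      by (rule continuous_on_compose2[OF G(1)]) (auto intro!: continuous_intros)
    show "(\<lambda>z. G (z, 1)) ` S \<subseteq> E" using G(2) by auto
    show "q (G (z, 1)) = f z" if "z \<in> S" for z
      using G(4)[OF that, of 1] by (simp add: h_def)
  qed
qed

section \<open>Circle-valued functions\<close>

text \<open>
  A lift through the exponential map, whose real part vanishes because the values have norm 1.
\<close>

lemma circle_valued_angle:
  fixes f :: "'c::real_normed_vector \<Rightarrow> complex"
  assumes "a \<in> S" "\<And>z. z \<in> S \<Longrightarrow> closed_segment a z \<subseteq> S"
    and "continuous_on S f" "f ` S \<subseteq> sphere 0 1"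
  obtains \<theta> where "continuous_on S \<theta>" "\<And>z. z \<in> S \<Longrightarrow> f z = cis (2 * pi * \<theta> z)"
proof -
  have "f ` S \<subseteq> - {0}" using assms(4) by auto
  then obtain l where l: "continuous_on S l" "\<And>z. z \<in> S \<Longrightarrow> exp (l z) = f z"
    using covering_space_lift_starlike[OF covering_space_exp_punctured_plane assms(1,2,3)]
    by metis
  show ?thesis
  proof
    show "continuous_on S (\<lambda>z. Im (l z) / (2 * pi))"
      by (intro continuous_intros l) auto
    fix z assume z: "z \<in> S"
    have "norm (f z) = 1" using assms(4) z by auto
    then have "exp (Re (l z)) = 1" using l(2)[OF z] by (metis norm_exp_eq_Re)
    then have "exp (l z) = cis (Im (l z))" by (simp add: exp_eq_polar)
    then show "f z = cis (2 * pi * (Im (l z) / (2 * pi)))" using l(2)[OF z] by simp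
  qed
qed

lemma cis_2pi_eq_1_iff: "cis (2 * pi * t) = 1 \<longleftrightarrow> t \<in> \<int>"
proof
  assume "cis (2 * pi * t) = 1"
  then have "cos (2 * pi * t) = 1" by (metis cis.sel(1) one_complex.sel(1))
  then obtain n :: int where "2 * pi * t = of_int n * 2 * pi" by (auto simp: cos_one_2pi_int)
  then have "t = of_int n" by simp
  then show "t \<in> \<int>" by simp
next
  assume "t \<in> \<int>"
  then show "cis (2 * pi * t) = 1" by (auto elim!: Ints_cases)
qed

lemma cis_2pi_eq_iff: "cis (2 * pi * s) = cis (2 * pi * t) \<longleftrightarrow> s - t \<in> \<int>"
proof -
  have "cis (2 * pi * s) = cis (2 * pi * t) \<longleftrightarrow> cis (2 * pi * s) / cis (2 * pi * t) = 1"
    by simp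
  also have "cis (2 * pi * s) / cis (2 * pi * t) = cis (2 * pi * (s - t))"
    by (simp add: cis_divide algebra_simps)
  finally show ?thesis by (simp add: cis_2pi_eq_1_iff)
qed

lemma sphere_eq_cis:
  assumes "w \<in> sphere (0::complex) 1"
  obtains t where "t \<in> {0..1}" "w = cis (2 * pi * t)"
proof -
  have w: "norm w = 1" "w \<noteq> 0" using assms by auto
  have "w = cis (Arg2pi w)" using complex_norm_eq_1_exp[of w] w
    by (metis Arg2pi_eq cis_conv_exp mult_1 of_real_1)
  then show ?thesis
    using Arg2pi_ge_0[of w] Arg2pi_lt_2pi[of w]
    by (intro that[of "Arg2pi w / (2 * pi)"]) (auto simp: divide_simps)
qed

section \<open>Local structure of principal circle bundles\<close>

text \<open>
  The local trivialization is used through its circle coordinate \<open>\<tau>\<close>, which is equivariant.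
\<close>

lemma principal_circle_bundle_chart:
  assumes "principal_circle_bundle P p F act" "b \<in> F"
  obtains U h \<tau> where "b \<in> U" "openin (top_of_set F) U"
    "continuous_on (U \<times> sphere 0 1) h" "continuous_on (P \<inter> p -` U) \<tau>"
    "\<And>y z. y \<in> U \<Longrightarrow> z \<in> sphere 0 1 \<Longrightarrow> h (y, z) \<in> P \<and> p (h (y, z)) = y \<and> \<tau> (h (y, z)) = z"
    "\<And>x. x \<in> P \<Longrightarrow> p x \<in> U \<Longrightarrow> \<tau> x \<in> sphere 0 1 \<and> h (p x, \<tau> x) = x"
    "\<And>x w. x \<in> P \<Longrightarrow> p x \<in> U \<Longrightarrow> w \<in> sphere 0 1 \<Longrightarrow> \<tau> (act x w) = \<tau> x * w"
proof -
  obtain U h k where U: "b \<in> U" "openin (top_of_set F) U"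
    "homeomorphism (U \<times> sphere 0 1) (P \<inter> p -` U) h k"
    and h: "\<And>y z. y \<in> U \<Longrightarrow> z \<in> sphere 0 1 \<Longrightarrow> p (h (y, z)) = y"
      "\<And>y z w. y \<in> U \<Longrightarrow> z \<in> sphere 0 1 \<Longrightarrow> w \<in> sphere 0 1 \<Longrightarrow> h (y, z * w) = act (h (y, z)) w"
    using assms unfolding principal_circle_bundle_def by metis
  define \<tau> where "\<tau> x = snd (k x)" for x
  have k: "continuous_on (P \<inter> p -` U) k" "continuous_on (U \<times> sphere 0 1) h"
    "\<And>x. x \<in> P \<Longrightarrow> p x \<in> U \<Longrightarrow> k x \<in> U \<times> sphere 0 1"
    "\<And>x. x \<in> P \<Longrightarrow> p x \<in> U \<Longrightarrow> h (k x) = x"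
    "\<And>y. y \<in> U \<times> sphere 0 1 \<Longrightarrow> h y \<in> P" "\<And>y. y \<in> U \<times> sphere 0 1 \<Longrightarrow> k (h y) = y"
    using U(3) unfolding homeomorphism_def by blast+
  have kx: "k x = (p x, \<tau> x) \<and> \<tau> x \<in> sphere 0 1" if "x \<in> P" "p x \<in> U" for x
    using h(1)[of "fst (k x)" "snd (k x)"] k(3,4)[OF that] by (auto simp: \<tau>_def prod_eq_iff)
  show ?thesis
  proof
    show "continuous_on (P \<inter> p -` U) \<tau>" unfolding \<tau>_def by (intro continuous_intros k)
    show "h (y, z) \<in> P \<and> p (h (y, z)) = y \<and> \<tau> (h (y, z)) = z"
      if "y \<in> U" "z \<in> sphere 0 1" for y z
      using h(1)[OF that] k(5,6)[of "(y, z)"] that by (auto simp: \<tau>_def)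
    show *: "\<tau> x \<in> sphere 0 1 \<and> h (p x, \<tau> x) = x" if "x \<in> P" "p x \<in> U" for x
      using kx[OF that] k(4)[OF that] by simp
    show "\<tau> (act x w) = \<tau> x * w" if "x \<in> P" "p x \<in> U" "w \<in> sphere 0 1" for x w
    proof -
      have "act x w = h (p x, \<tau> x * w)"
        using h(2)[of "p x" "\<tau> x" w] *[OF that(1,2)] that by auto
      moreover have "\<tau> x * w \<in> sphere 0 1"
        using *[OF that(1,2)] that by (auto simp: norm_mult)
      ultimately show ?thesis using k(6)[of "(p x, \<tau> x * w)"] that by (simp add: \<tau>_def)
    qed
  qed (use U k in auto)
qed

lemma principal_circle_bundle_free:
  assumes B: "principal_circle_bundle P p F act" and "x \<in> P" "z \<in> sphere 0 1" "w \<in> sphere 0 1"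
    "act x z = act x w"
  shows "z = w"
proof -
  have "p x \<in> F" using assms by (auto simp: principal_circle_bundle_def)
  then obtain U h \<tau> where c: "p x \<in> U"
    "\<And>x. x \<in> P \<Longrightarrow> p x \<in> U \<Longrightarrow> \<tau> x \<in> sphere 0 1 \<and> h (p x, \<tau> x) = x"
    "\<And>x w. x \<in> P \<Longrightarrow> p x \<in> U \<Longrightarrow> w \<in> sphere 0 1 \<Longrightarrow> \<tau> (act x w) = \<tau> x * w"
    using principal_circle_bundle_chart[OF B, of "p x"] by metis
  have "\<tau> x * z = \<tau> x * w" using c assms by metis
  moreover have "\<tau> x \<noteq> 0" using c(2)[OF assms(2) c(1)] by auto
  ultimately show ?thesis by simp
qed

text \<open>
  Two points of one fibre differ by a unique element of the circle, since the action is free and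
  transitive on fibres. In a chart it is the quotient of the circle coordinates, hence it depends
  continuously on the two points.
\<close>

lemma principal_circle_bundle_division:
  assumes B: "principal_circle_bundle P p F act"
  obtains d where "continuous_on {(x, y). x \<in> P \<and> y \<in> P \<and> p x = p y} d"
    "\<And>x y. x \<in> P \<Longrightarrow> y \<in> P \<Longrightarrow> p x = p y \<Longrightarrow> d (x, y) \<in> sphere 0 1 \<and> act x (d (x, y)) = y"
proof -
  define d where "d = (\<lambda>(x, y). THE w. w \<in> sphere 0 1 \<and> act x w = y)"
  define R where "R = {(x, y). x \<in> P \<and> y \<in> P \<and> p x = p y}"
  have act: "\<And>x w. x \<in> P \<Longrightarrow> w \<in> sphere 0 1 \<Longrightarrow> act x w \<in> P \<and> p (act x w) = p x"
    and p: "continuous_on P p" "p ` P = F"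
    using B by (auto simp: principal_circle_bundle_def)
  have d_eq: "d (x, act x w) = w" if "x \<in> P" "w \<in> sphere 0 1" for x w
    unfolding d_def using principal_circle_bundle_free[OF B that(1)] that by (auto intro!: the_equality)
  have loc: "\<exists>W. openin (top_of_set R) W \<and> v \<in> W \<and> continuous_on W d \<and>
      (\<forall>x y. (x, y) \<in> W \<longrightarrow> d (x, y) \<in> sphere 0 1 \<and> act x (d (x, y)) = y)"
    if "v \<in> R" for v
  proof -
    obtain a b where v: "v = (a, b)" "a \<in> P" "b \<in> P" "p a = p b" using \<open>v \<in> R\<close> by (auto simp: R_def)
    have "p a \<in> F" using v p by auto
    then obtain U h \<tau> where c: "p a \<in> U" "openin (top_of_set F) U"
      "continuous_on (U \<times> sphere 0 1) h" "continuous_on (P \<inter> p -` U) \<tau>"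
      "\<And>y z. y \<in> U \<Longrightarrow> z \<in> sphere 0 1 \<Longrightarrow> h (y, z) \<in> P \<and> p (h (y, z)) = y \<and> \<tau> (h (y, z)) = z"
      "\<And>x. x \<in> P \<Longrightarrow> p x \<in> U \<Longrightarrow> \<tau> x \<in> sphere 0 1 \<and> h (p x, \<tau> x) = x"
      "\<And>x w. x \<in> P \<Longrightarrow> p x \<in> U \<Longrightarrow> w \<in> sphere 0 1 \<Longrightarrow> \<tau> (act x w) = \<tau> x * w"
      by (rule principal_circle_bundle_chart[OF B]) blast
    define W where "W = R \<inter> (\<lambda>v. p (fst v)) -` U"
    have d: "d (x, y) = \<tau> y / \<tau> x \<and> d (x, y) \<in> sphere 0 1 \<and> act x (d (x, y)) = y"
      if xy: "(x, y) \<in> W" for x y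
    proof -
      have x: "x \<in> P" "p x \<in> U" and y: "y \<in> P" "p y \<in> U" "p y = p x"
        using xy by (auto simp: W_def R_def)
      define w where "w = \<tau> y / \<tau> x"
      have n: "norm (\<tau> x) = 1" "norm (\<tau> y) = 1" using c(6)[OF x] c(6)[OF y(1,2)] by auto
      then have w: "w \<in> sphere 0 1" by (simp add: w_def norm_divide)
      have "\<tau> (act x w) = \<tau> y" using c(7)[OF x w] n by (auto simp: w_def)
      then have "act x w = y"
        using c(6)[of "act x w"] c(6)[OF y(1,2)] act[OF x(1) w] x y by metis
      then show ?thesis using d_eq[OF x(1) w] w by (auto simp: w_def)
    qed
    have "openin (top_of_set R) W" unfolding W_def
    proof (rule continuous_openin_preimage[where T=F])
      show "continuous_on R (\<lambda>v. p (fst v))"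
        by (rule continuous_on_compose2[OF p(1)]) (auto simp: R_def intro!: continuous_intros)
    qed (use p c(2) in \<open>auto simp: R_def\<close>)
    moreover have "v \<in> W" using v c(1) by (auto simp: W_def R_def)
    moreover have "continuous_on W (\<lambda>v. \<tau> (snd v) / \<tau> (fst v))"
    proof (intro continuous_intros)
      show "continuous_on W (\<lambda>v. \<tau> (snd v))"
        by (rule continuous_on_compose2[OF c(4)]) (auto simp: W_def R_def intro!: continuous_intros)
      show "continuous_on W (\<lambda>v. \<tau> (fst v))"
        by (rule continuous_on_compose2[OF c(4)]) (auto simp: W_def R_def intro!: continuous_intros)
      show "\<forall>v\<in>W. \<tau> (fst v) \<noteq> 0"
      proof
        fix v assume "v \<in> W"
        then have "fst v \<in> P" "p (fst v) \<in> U" by (auto simp: W_def R_def)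
        from c(6)[OF this] show "\<tau> (fst v) \<noteq> 0" by auto
      qed
    qed
    then have "continuous_on W d"
      by (rule continuous_on_eq) (use d in \<open>auto simp: split_def\<close>)
    ultimately show ?thesis using d by blast
  qed
  show ?thesis
  proof
    show "continuous_on {(x, y). x \<in> P \<and> y \<in> P \<and> p x = p y} d"
      unfolding R_def[symmetric] using loc by (intro continuous_on_locally_openin) blast
    show "d (x, y) \<in> sphere 0 1 \<and> act x (d (x, y)) = y" if "x \<in> P" "y \<in> P" "p x = p y" for x y
      using loc[of "(x, y)"] that by (auto simp: R_def)
  qed
qed

section \<open>Unwrapping the bundle over the 2-cell\<close>

text \<open>
  \<open>K\<close> is a section of the bundle over the 2-cell, so that the pulled back bundle is \<open>D \<times> S\<^sup>1\<close>.
\<close>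

locale trivialized_cell =
  fixes \<kappa> :: "complex \<Rightarrow> 'b::topological_space" and F :: "'b set"
    and P :: "'p::topological_space set" and p :: "'p \<Rightarrow> 'b" and act :: "'p \<Rightarrow> complex \<Rightarrow> 'p"
    and K :: "complex \<Rightarrow> 'p"
  assumes quotient_cell: "quotient_map (top_of_set (cball 0 1)) (top_of_set F) \<kappa>"
    and principal: "principal_circle_bundle P p F act"
    and cont_K: "continuous_on (cball 0 1) K"
    and K_in: "z \<in> cball 0 1 \<Longrightarrow> K z \<in> P"
    and p_K: "z \<in> cball 0 1 \<Longrightarrow> p (K z) = \<kappa> z"
begin

definition unwrap :: "complex \<times> real \<Rightarrow> 'p" where
  "unwrap = (\<lambda>(z, t). act (K z) (cis (2 * pi * t)))"

lemma bundle_facts: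
  "continuous_on P p" "p ` P = F"
  "continuous_on (P \<times> sphere 0 1) (\<lambda>(x, z). act x z)"
  "\<And>x z. x \<in> P \<Longrightarrow> z \<in> sphere 0 1 \<Longrightarrow> act x z \<in> P"
  "\<And>x z. x \<in> P \<Longrightarrow> z \<in> sphere 0 1 \<Longrightarrow> p (act x z) = p x"
  "\<And>x. x \<in> P \<Longrightarrow> act x 1 = x"
  "\<And>x z w. x \<in> P \<Longrightarrow> z \<in> sphere 0 1 \<Longrightarrow> w \<in> sphere 0 1 \<Longrightarrow> act (act x z) w = act x (z * w)"
  using principal unfolding principal_circle_bundle_def by blast+

lemma cell_facts: "continuous_on (cball 0 1) \<kappa>" "\<kappa> ` cball 0 1 = F"
  using quotient_imp_continuous_map[OF quotient_cell] quotient_imp_surjective_map[OF quotient_cell] by auto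

lemma continuous_on_act:
  assumes "continuous_on S f" "continuous_on S g" "f ` S \<subseteq> P" "g ` S \<subseteq> sphere 0 1"
  shows "continuous_on S (\<lambda>s. act (f s) (g s))"
proof -
  have "continuous_on S (\<lambda>s. (\<lambda>(x, z). act x z) (f s, g s))"
    by (rule continuous_on_compose2[OF bundle_facts(3)])
       (use assms in \<open>auto intro!: continuous_intros\<close>)
  then show ?thesis by simp
qed

lemma unwrap_in: "z \<in> cball 0 1 \<Longrightarrow> unwrap (z, t) \<in> P"
  by (auto simp: unwrap_def intro!: bundle_facts K_in)

lemma p_unwrap: "z \<in> cball 0 1 \<Longrightarrow> p (unwrap (z, t)) = \<kappa> z"
  by (simp add: unwrap_def bundle_facts K_in p_K)

lemma act_unwrap: "z \<in> cball 0 1 \<Longrightarrow> act (unwrap (z, t)) (cis (2 * pi * s)) = unwrap (z, t + s)"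
  by (simp add: unwrap_def bundle_facts K_in cis_mult algebra_simps)

lemma continuous_on_unwrap: "continuous_on (cball 0 1 \<times> UNIV) unwrap"
  unfolding unwrap_def split_def
  by (intro continuous_on_act continuous_intros continuous_on_compose2[OF cont_K])
     (auto intro!: K_in)

lemma unwrap_eq_iff: "z \<in> cball 0 1 \<Longrightarrow> unwrap (z, s) = unwrap (z, t) \<longleftrightarrow> s - t \<in> \<int>"
  unfolding cis_2pi_eq_iff[symmetric]
  using principal_circle_bundle_free[OF principal K_in, of z "cis (2 * pi * s)" "cis (2 * pi * t)"]
  by (auto simp: unwrap_def)

lemma unwrap_over:
  assumes "x \<in> P" "z \<in> cball 0 1" "p x = \<kappa> z"
  obtains t where "t \<in> {0..1}" "unwrap (z, t) = x"
proof -
  obtain d where "\<And>x y. x \<in> P \<Longrightarrow> y \<in> P \<Longrightarrow> p x = p y \<Longrightarrow>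
      d (x, y) \<in> sphere 0 1 \<and> act x (d (x, y)) = y"
    using principal_circle_bundle_division[OF principal] by metis
  then have "d (K z, x) \<in> sphere 0 1" "act (K z) (d (K z, x)) = x"
    using assms K_in p_K by auto
  then show ?thesis
    using that sphere_eq_cis[of "d (K z, x)"] by (metis case_prod_conv unwrap_def)
qed

lemma unwrap_surj:
  assumes "x \<in> P"
  obtains z t where "z \<in> cball 0 1" "t \<in> {0..1}" "unwrap (z, t) = x"
proof -
  have "p x \<in> \<kappa> ` cball 0 1" using assms bundle_facts(2) cell_facts(2) by auto
  then obtain z where "z \<in> cball 0 1" "p x = \<kappa> z" by blast
  then show ?thesis using unwrap_over[OF assms] that by metis
qed

text \<open>
  The map from \<open>D \<times> S\<^sup>1\<close> to \<open>P\<close> given by the section \<open>K\<close> is a quotient map. Over a chart domain \<open>U\<close> it becomes,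
  after a rotation of each circle that depends continuously on \<open>z\<close>, the product of \<open>\<kappa>\<close> with the identity of
  the circle; and such a product is a quotient map because the circle is compact.
\<close>

lemma openin_bundle_if_openin_cell_circle:
  assumes "B \<subseteq> P"
    and op: "openin (top_of_set (cball 0 1 \<times> sphere 0 1))
      {v \<in> cball 0 1 \<times> sphere 0 1. act (K (fst v)) (snd v) \<in> B}" (is "openin ?DS ?A")
  shows "openin (top_of_set P) B"
proof (subst openin_subopen, intro ballI)
  fix x assume "x \<in> B"
  then have "p x \<in> F" using assms bundle_facts(2) by auto
  then obtain U h \<tau> where c: "p x \<in> U" "openin (top_of_set F) U"
    "continuous_on (U \<times> sphere 0 1) h" "continuous_on (P \<inter> p -` U) \<tau>"
    "\<And>y z. y \<in> U \<Longrightarrow> z \<in> sphere 0 1 \<Longrightarrow> h (y, z) \<in> P \<and> p (h (y, z)) = y \<and> \<tau> (h (y, z)) = z"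
    "\<And>x. x \<in> P \<Longrightarrow> p x \<in> U \<Longrightarrow> \<tau> x \<in> sphere 0 1 \<and> h (p x, \<tau> x) = x"
    "\<And>x w. x \<in> P \<Longrightarrow> p x \<in> U \<Longrightarrow> w \<in> sphere 0 1 \<Longrightarrow> \<tau> (act x w) = \<tau> x * w"
    by (rule principal_circle_bundle_chart[OF principal]) blast
  have UF: "U \<subseteq> F" using c(2) by (rule openin_imp_subset)
  define DU where "DU = cball 0 1 \<inter> \<kappa> -` U"
  define A where "A = {v \<in> F \<times> sphere 0 1. fst v \<in> U \<and> h v \<in> B}"
  \<comment> \<open>The rotation from the coordinate given by the section \<open>K\<close> to that of the chart, cf. \<open>h_r\<close> below.\<close>
  define r where "r = (\<lambda>v. (fst v, snd v / \<tau> (K (fst v))))"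
  have K_DU: "K z \<in> P" "p (K z) \<in> U" "norm (\<tau> (K z)) = 1" if "z \<in> DU" for z
    using that K_in[of z] p_K[of z] c(6)[of "K z"] by (auto simp: DU_def)
  have h_r: "act (K z) (w / \<tau> (K z)) = h (\<kappa> z, w)" if "z \<in> DU" "w \<in> sphere 0 1" for z w
  proof -
    have n: "w / \<tau> (K z) \<in> sphere 0 1" using K_DU that by (simp add: norm_divide)
    have "\<tau> (K z) \<noteq> 0" using K_DU(3)[OF that(1)] by auto
    then have "\<tau> (act (K z) (w / \<tau> (K z))) = w"
      using c(7)[OF K_DU(1,2)[OF that(1)] n] by simp
    moreover have "act (K z) (w / \<tau> (K z)) \<in> P" "p (act (K z) (w / \<tau> (K z))) = \<kappa> z"
      using bundle_facts(4,5)[OF K_DU(1)[OF that(1)] n] p_K[of z] that by (auto simp: DU_def)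
    moreover have "\<kappa> z \<in> U" using that by (simp add: DU_def)
    ultimately show ?thesis using c(6) by metis
  qed
  have "openin (top_of_set (cball 0 1)) DU"
    unfolding DU_def by (rule continuous_openin_preimage[where T=F]) (use cell_facts c(2) in auto)
  then have DU_open: "openin ?DS (DU \<times> sphere 0 1)" by (intro openin_Times) auto
  have "continuous_on (DU \<times> sphere 0 1) r"
    unfolding r_def
  proof (intro continuous_intros)
    show "continuous_on (DU \<times> sphere 0 1) (\<lambda>v. \<tau> (K (fst v)))"
    proof (rule continuous_on_compose2[OF c(4)])
      show "continuous_on (DU \<times> sphere 0 1) (\<lambda>v. K (fst v))"
        by (rule continuous_on_compose2[OF cont_K]) (auto simp: DU_def intro!: continuous_intros)
    qed (use K_DU in auto)
    show "\<forall>v\<in>DU \<times> sphere 0 1. \<tau> (K (fst v)) \<noteq> 0" using K_DU(3) by fastforce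
  qed
  moreover have "r ` (DU \<times> sphere 0 1) \<subseteq> cball 0 1 \<times> sphere 0 1"
    using K_DU by (auto simp: r_def DU_def norm_divide)
  ultimately have "openin (top_of_set (DU \<times> sphere 0 1)) (DU \<times> sphere 0 1 \<inter> r -` ?A)"
    using op by (intro continuous_openin_preimage) auto
  then have "openin ?DS (DU \<times> sphere 0 1 \<inter> r -` ?A)"
    using DU_open openin_trans by blast
  also have "DU \<times> sphere 0 1 \<inter> r -` ?A =
      {v \<in> cball 0 1 \<times> sphere 0 1. (\<lambda>(z, w). (\<kappa> z, w)) v \<in> A}"
  proof (rule Set.set_eqI)
    fix v :: "complex \<times> complex"
    obtain z w where [simp]: "v = (z, w)" by (cases v)
    show "v \<in> DU \<times> sphere 0 1 \<inter> r -` ?A \<longleftrightarrow>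
      v \<in> {v \<in> cball 0 1 \<times> sphere 0 1. (\<lambda>(z, w). (\<kappa> z, w)) v \<in> A}"
    proof (cases "z \<in> DU \<and> w \<in> sphere 0 1")
      case True
      then have "r (z, w) \<in> ?A \<longleftrightarrow> h (\<kappa> z, w) \<in> B"
        using h_r[of z w] K_DU(3)[of z] by (auto simp: r_def norm_divide DU_def)
      then show ?thesis using True UF by (auto simp: A_def DU_def)
    next
      case False
      then show ?thesis by (auto simp: A_def DU_def)
    qed
  qed
  finally have pre: "openin ?DS {v \<in> cball 0 1 \<times> sphere 0 1. (\<lambda>(z, w). (\<kappa> z, w)) v \<in> A}" .
  have "quotient_map (prod_topology (top_of_set (cball 0 1)) (top_of_set (sphere (0::complex) 1)))
      (prod_topology (top_of_set F) (top_of_set (sphere 0 1))) (\<lambda>(z, w). (\<kappa> z, w))"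
    by (rule quotient_map_prod_left[OF _ _ quotient_cell])
       (auto simp: compact_imp_locally_compact_space compact_space_subtopology Hausdorff_space_subtopology)
  then have "quotient_map ?DS (top_of_set (F \<times> sphere 0 1)) (\<lambda>(z, w). (\<kappa> z, w))"
    by simp
  then have "\<forall>V\<subseteq>F \<times> sphere 0 1.
      openin ?DS {v \<in> cball 0 1 \<times> sphere 0 1. (\<lambda>(z, w). (\<kappa> z, w)) v \<in> V} \<longleftrightarrow>
      openin (top_of_set (F \<times> sphere 0 1)) V"
    unfolding quotient_map_def topspace_euclidean_subtopology by (rule conjunct2)
  moreover have "A \<subseteq> F \<times> sphere 0 1" unfolding A_def by blast
  ultimately have "openin (top_of_set (F \<times> sphere 0 1)) A"
    using pre by blast
  then have A: "openin (top_of_set (U \<times> sphere 0 1)) A"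
    by (rule openin_subset_trans) (use UF in \<open>auto simp: A_def\<close>)
  have "openin (top_of_set (P \<inter> p -` U)) (P \<inter> p -` U \<inter> (\<lambda>x. (p x, \<tau> x)) -` A)"
  proof (rule continuous_openin_preimage[OF _ _ A])
    show "continuous_on (P \<inter> p -` U) (\<lambda>x. (p x, \<tau> x))"
      by (intro continuous_intros c(4) continuous_on_subset[OF bundle_facts(1)]) auto
  qed (use c(6) in auto)
  moreover have "openin (top_of_set P) (P \<inter> p -` U)"
    by (rule continuous_openin_preimage[where T=F]) (use bundle_facts c(2) in auto)
  ultimately have "openin (top_of_set P) (P \<inter> p -` U \<inter> (\<lambda>x. (p x, \<tau> x)) -` A)"
    using openin_trans by blast
  also have "P \<inter> p -` U \<inter> (\<lambda>x. (p x, \<tau> x)) -` A = B \<inter> p -` U"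
    using c(6) \<open>B \<subseteq> P\<close> UF by (auto simp: A_def)
  finally show "\<exists>T. openin (top_of_set P) T \<and> x \<in> T \<and> T \<subseteq> B"
    using \<open>x \<in> B\<close> c(1) by blast
qed

text \<open>
  The angle map from \<open>{0..1}\<close> to the circle is a quotient map of compact spaces, also after
  multiplication with the disc.
\<close>

lemma unwrap_quotient:
  assumes "B \<subseteq> P" "openin (top_of_set (cball 0 1 \<times> UNIV)) {v \<in> cball 0 1 \<times> UNIV. unwrap v \<in> B}"
  shows "openin (top_of_set P) B"
proof (rule openin_bundle_if_openin_cell_circle[OF assms(1)])
  let ?A = "{v \<in> cball 0 1 \<times> sphere 0 1. act (K (fst v)) (snd v) \<in> B}"
  define e :: "complex \<times> real \<Rightarrow> complex \<times> complex" where "e = (\<lambda>(z, t). (z, cis (2 * pi * t)))"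
  have surj: "e ` (cball 0 1 \<times> {0..1}) = cball 0 1 \<times> sphere 0 1"
  proof (intro Set.set_eqI iffI)
    fix v :: "complex \<times> complex" assume v: "v \<in> cball 0 1 \<times> sphere 0 1"
    then have "snd v \<in> sphere 0 1" by auto
    then obtain t where "t \<in> {0..1}" "snd v = cis (2 * pi * t)"
      by (rule sphere_eq_cis)
    then have "v = e (fst v, t)" "(fst v, t) \<in> cball 0 1 \<times> {0..1}"
      using v by (auto simp: e_def prod_eq_iff)
    then show "v \<in> e ` (cball 0 1 \<times> {0..1})" by blast
  qed (auto simp: e_def)
  have "quotient_map (top_of_set (cball 0 1 \<times> {0..1})) (top_of_set (cball 0 1 \<times> sphere 0 1)) e"
  proof (rule T1_Spaces.continuous_imp_quotient_map)
    show "continuous_map (top_of_set (cball 0 1 \<times> {0..1})) (top_of_set (cball 0 1 \<times> sphere 0 1)) e"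
      by (auto simp: e_def split_def intro!: continuous_intros)
  qed (use surj in \<open>auto simp: compact_space_subtopology compact_Times Hausdorff_space_subtopology\<close>)
  then have Q: "\<forall>V\<subseteq>cball 0 1 \<times> sphere 0 1. openin (top_of_set (cball 0 1 \<times> {0..1}))
      {v \<in> cball 0 1 \<times> {0..1}. e v \<in> V} \<longleftrightarrow> openin (top_of_set (cball 0 1 \<times> sphere 0 1)) V"
    unfolding quotient_map_def topspace_euclidean_subtopology by (rule conjunct2)
  have pre: "{v \<in> cball 0 1 \<times> {0..1}. e v \<in> ?A} =
      (cball 0 1 \<times> {0..1}) \<inter> {v \<in> cball 0 1 \<times> UNIV. unwrap v \<in> B}"
    by (auto simp: e_def unwrap_def)
  have "openin (top_of_set (cball 0 1 \<times> {0..1}))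
      ((cball 0 1 \<times> {0..1}) \<inter> {v \<in> cball 0 1 \<times> UNIV. unwrap v \<in> B})"
  proof -
    obtain T where "open T" "{v \<in> cball 0 1 \<times> UNIV. unwrap v \<in> B} = cball 0 1 \<times> UNIV \<inter> T"
      using assms(2) unfolding openin_open by blast
    moreover have "(cball 0 1 \<times> {0..1}) \<inter> (cball 0 1 \<times> UNIV \<inter> T) = (cball 0 1 \<times> {0..1}) \<inter> T"
      for T :: "(complex \<times> real) set" by blast
    ultimately show ?thesis unfolding openin_open by metis
  qed
  then have "openin (top_of_set (cball 0 1 \<times> {0..1})) {v \<in> cball 0 1 \<times> {0..1}. e v \<in> ?A}"
    by (simp only: pre)
  moreover have "?A \<subseteq> cball 0 1 \<times> sphere 0 1" by blast
  ultimately show "openin (top_of_set (cball 0 1 \<times> sphere 0 1)) ?A"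
    using Q by blast
qed

end

section \<open>Special double coverings as quotients of the unwrapped cell\<close>

lemma connected_cball_line: "connected (cball (0::complex) 1 \<times> (UNIV :: real set))"
  by (intro convex_connected convex_Times) auto

context trivialized_cell begin

text \<open>
  The data extracted from a special double covering. The inequality is the trace of the
  condition \<open>\<phi> u\<^sub>0 = 1\<close>, spread from the base point to all fibres.
\<close>

definition double_lift ::
  "'e::topological_space set \<Rightarrow> ('e \<Rightarrow> 'p) \<Rightarrow> (complex \<times> real \<Rightarrow> 'e) \<Rightarrow> bool" where
  "double_lift E q L \<longleftrightarrow> covering_space E q P \<and> (\<forall>y\<in>P. card {e \<in> E. q e = y} = 2) \<and>
     continuous_on (cball 0 1 \<times> UNIV) L \<and>
     (\<forall>z\<in>cball 0 1. \<forall>t. L (z, t) \<in> E \<and> q (L (z, t)) = unwrap (z, t) \<and> L (z, t + 1) \<noteq> L (z, t))"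

lemma unwrap_shift_int:
  assumes "z \<in> cball 0 1" "s - t \<in> \<int>" shows "unwrap (z, s) = unwrap (z, t)"
  using assms unwrap_eq_iff by simp

text \<open>
  Both sides are lifts of \<open>unwrap\<close>, and \<open>D \<times> \<real>\<close> is connected.
\<close>

lemma lift_period_everywhere:
  assumes cov: "covering_space E q P"
    and L: "continuous_on (cball 0 1 \<times> UNIV) L" "L ` (cball 0 1 \<times> UNIV) \<subseteq> E"
      "\<And>v. v \<in> cball 0 1 \<times> UNIV \<Longrightarrow> q (L v) = unwrap v"
    and "z \<in> cball 0 1" "L (z, t + 1) = L (z, t)" "w \<in> cball 0 1"
  shows "L (w, s + 1) = L (w, s)"
proof -
  have "L (fst (w, s), snd (w, s) + 1) = L (w, s)"
  proof (rule covering_space_lifts_agree[OF cov connected_cball_line, of "\<lambda>v. L (fst v, snd v + 1)"])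
    show "continuous_on (cball 0 1 \<times> UNIV) (\<lambda>v. L (fst v, snd v + 1))"
      by (rule continuous_on_compose2[OF L(1)]) (auto intro!: continuous_intros)
    show "q (L (fst v, snd v + 1)) = q (L v)" if "v \<in> cball 0 1 \<times> UNIV" for v
      using that L(3)[of v] L(3)[of "(fst v, snd v + 1)"]
        unwrap_shift_int[of "fst v" "snd v + 1" "snd v"] by (auto simp: mem_Times_iff)
    show "(z, t) \<in> cball 0 1 \<times> UNIV" using assms by simp
    show "(\<lambda>v. L (fst v, snd v + 1)) ` (cball 0 1 \<times> UNIV) \<subseteq> E" using L(2) by auto
  qed (use L assms in auto)
  then show ?thesis by simp
qed

lemma lift_period_int:
  assumes "\<And>s. L (z, s + 1) = L (z, s)" "s - t \<in> \<int>"
  shows "L (z, s::real) = L (z, t)"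
proof -
  have nat: "L (z, s + of_nat n) = L (z, s)" for n s
  proof (induction n)
    case (Suc n)
    have "L (z, s + of_nat (Suc n)) = L (z, (s + of_nat n) + 1)" by (simp add: algebra_simps)
    then show ?case using assms(1) Suc by simp
  qed simp
  obtain k :: int where k: "s - t = of_int k" using assms(2) by (auto elim: Ints_cases)
  show ?thesis
  proof (cases "k \<ge> 0")
    case True
    then have "s = t + of_nat (nat k)" using k by simp
    then show ?thesis using nat by simp
  next
    case False
    then have "t = s + of_nat (nat (- k))" using k by simp
    then show ?thesis using nat by simp
  qed
qed

text \<open>
  If a lift \<open>L\<close> of \<open>unwrap\<close> closed up after one turn at some point, it would do so everywhere. A loop in the
  circle that represents \<open>\<omega>\<close> is \<open>cis (2 * pi * a)\<close> for a real path \<open>a\<close> with integral ends, so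
  moving along \<open>L\<close> by \<open>a\<close> would lift a representative of \<open>u\<^sub>0\<close> to a closed path, although \<open>\<phi> u\<^sub>0 = 1\<close>.
\<close>

lemma special_double_covering_lift:
  fixes E :: "'e::topological_space set"
  assumes "special_double_covering E q P x\<^sub>0 u\<^sub>0 \<phi>" "u\<^sub>0 = fiber_class P act x\<^sub>0 \<omega>"
    "x\<^sub>0 \<in> P" "\<omega> \<in> carrier (fundamental_group (sphere 0 1) 1)"
  obtains L where "double_lift E q L"
proof -
  have cov: "covering_space E q P" and card2: "\<forall>y\<in>P. card {e \<in> E. q e = y} = 2"
    and \<phi>: "\<And>\<eta>. path \<eta> \<Longrightarrow> path_image \<eta> \<subseteq> E \<Longrightarrow> q (pathstart \<eta>) = x\<^sub>0 \<Longrightarrow> q (pathfinish \<eta>) = x\<^sub>0 \<Longrightarrow>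
        \<phi> (path_class P (q \<circ> \<eta>)) = 0 \<longleftrightarrow> pathfinish \<eta> = pathstart \<eta>"
    and one: "\<phi> u\<^sub>0 = 1"
    using assms(1) unfolding special_double_covering_def double_covering_def by blast+
  have seg: "closed_segment (0, 0) v \<subseteq> cball (0::complex) 1 \<times> (UNIV :: real set)"
    if "v \<in> cball 0 1 \<times> UNIV" for v
    using that by (intro closed_segment_subset convex_Times) auto
  have img: "unwrap ` (cball 0 1 \<times> UNIV) \<subseteq> P" using unwrap_in by auto
  have base: "(0, 0) \<in> cball (0::complex) 1 \<times> (UNIV :: real set)" by simp
  have "\<exists>L. continuous_on (cball 0 1 \<times> UNIV) L \<and> L ` (cball 0 1 \<times> UNIV) \<subseteq> E \<and>
      (\<forall>v\<in>cball 0 1 \<times> UNIV. q (L v) = unwrap v)"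
  proof (rule covering_space_lift_starlike[OF cov base seg continuous_on_unwrap img])
    fix G assume "continuous_on (cball 0 1 \<times> UNIV) G" "G ` (cball 0 1 \<times> UNIV) \<subseteq> E"
      "\<And>v. v \<in> cball 0 1 \<times> UNIV \<Longrightarrow> q (G v) = unwrap v"
    then show ?thesis by (intro exI[of _ G]) simp
  qed
  then obtain L where L12: "continuous_on (cball 0 1 \<times> UNIV) L" "L ` (cball 0 1 \<times> UNIV) \<subseteq> E"
    and qL: "\<forall>v\<in>cball 0 1 \<times> UNIV. q (L v) = unwrap v" by blast
  note L = L12 bspec[OF qL]
  have "L (z, t + 1) \<noteq> L (z, t)" if z: "z \<in> cball 0 1" for z t
  proof
    assume closed: "L (z, t + 1) = L (z, t)"
    have per: "L (w, s) = L (w, s')" if w: "w \<in> cball 0 1" and st: "s - s' \<in> \<int>" for w s s'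
      by (rule lift_period_int[OF lift_period_everywhere[OF cov L z closed w] st])
    obtain \<alpha> where \<alpha>: "\<omega> = path_class (sphere 0 1) \<alpha>" "\<alpha> \<in> based_loops (sphere 0 1) 1"
      using assms(4) by (auto simp: fundamental_group_def)
    then have \<alpha>': "continuous_on {0..1} \<alpha>" "\<alpha> ` {0..1} \<subseteq> sphere 0 1" "\<alpha> 0 = 1" "\<alpha> 1 = 1"
      by (auto simp: based_loops_def path_def path_image_def pathstart_def pathfinish_def)
    obtain a where a: "continuous_on {0..1} a" "\<And>s. s \<in> {0..1} \<Longrightarrow> \<alpha> s = cis (2 * pi * a s)"
      by (rule circle_valued_angle[OF _ _ \<alpha>'(1,2), of 0])
        (auto simp: closed_segment_eq_real_ivl)
    have a01: "a 0 \<in> \<int>" "a 1 \<in> \<int>"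
      using a(2)[of 0] a(2)[of 1] \<alpha>'(3,4) cis_2pi_eq_1_iff by auto
    obtain z0 t0 where x0: "z0 \<in> cball 0 1" "unwrap (z0, t0) = x\<^sub>0"
      using unwrap_surj[OF assms(3)] by metis
    define \<eta> where "\<eta> s = L (z0, t0 + a s)" for s
    have "path \<eta>" unfolding path_def \<eta>_def
      by (rule continuous_on_compose2[OF L(1)]) (use x0 a in \<open>auto intro!: continuous_intros\<close>)
    moreover have "path_image \<eta> \<subseteq> E" using L(2) x0 by (auto simp: \<eta>_def path_image_def)
    moreover have q\<eta>: "q (\<eta> s) = act x\<^sub>0 (\<alpha> s)" if "s \<in> {0..1}" for s
      using L(3)[of "(z0, t0 + a s)"] x0 a(2)[OF that] act_unwrap[OF x0(1), of t0 "a s"]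
      by (simp add: \<eta>_def)
    moreover have "q (pathstart \<eta>) = x\<^sub>0" "q (pathfinish \<eta>) = x\<^sub>0"
      using q\<eta>[of 0] q\<eta>[of 1] \<alpha>' bundle_facts(6)[OF assms(3)]
      by (auto simp: pathstart_def pathfinish_def)
    moreover have "pathfinish \<eta> = pathstart \<eta>"
      unfolding pathstart_def pathfinish_def \<eta>_def using x0 a01 by (intro per) auto
    ultimately have "\<phi> (path_class P (q \<circ> \<eta>)) = 0" using \<phi> by blast
    moreover have "path_class P (q \<circ> \<eta>) = u\<^sub>0"
    proof -
      have act0: "continuous_on (sphere 0 1) (act x\<^sub>0)"
        using assms(3) by (intro continuous_on_act continuous_intros) auto
      have "u\<^sub>0 = path_class P (act x\<^sub>0 \<circ> \<alpha>)"
        unfolding assms(2) fiber_class_def \<alpha>(1)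
        using \<alpha>(2) act0 by (rule fundamental_map_path_class) (use bundle_facts(4) assms(3) in auto)
      also have "\<dots> = path_class P (q \<circ> \<eta>)"
      proof (rule path_class_eq, rule homotopic_paths_eq)
        show "path (act x\<^sub>0 \<circ> \<alpha>)"
          unfolding path_def using act0 \<alpha>'(1,2)
          by (intro continuous_on_compose) (auto intro: continuous_on_subset)
        show "path_image (act x\<^sub>0 \<circ> \<alpha>) \<subseteq> P"
          using bundle_facts(4)[OF assms(3)] \<alpha>'(2) by (auto simp: path_image_def)
      qed (use q\<eta> in auto)
      finally show ?thesis ..
    qed
    ultimately show False using one by simp
  qed
  then have "double_lift E q L"
    unfolding double_lift_def using cov card2 L by (auto simp: image_subset_iff)
  then show ?thesis by (rule that)
qed

lemma double_lift_facts:
  assumes "double_lift E q L"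
  shows "covering_space E q P" "continuous_on (cball 0 1 \<times> UNIV) L"
    "\<And>z t. z \<in> cball 0 1 \<Longrightarrow> L (z, t) \<in> E" "\<And>z t. z \<in> cball 0 1 \<Longrightarrow> q (L (z, t)) = unwrap (z, t)"
    "\<And>z t. z \<in> cball 0 1 \<Longrightarrow> L (z, t + 1) \<noteq> L (z, t)"
  using assms unfolding double_lift_def by blast+

lemma double_lift_fibre:
  assumes L: "double_lift E q L" and z: "z \<in> cball 0 1" and e: "e \<in> E" "q e = unwrap (z, t)"
  shows "e = L (z, t) \<or> e = L (z, t + 1)"
proof -
  have "card {e \<in> E. q e = unwrap (z, t)} = 2"
    using L unwrap_in[OF z] by (simp add: double_lift_def)
  then obtain a b where ab: "{e \<in> E. q e = unwrap (z, t)} = {a, b}" by (auto simp: card_2_iff)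
  have "L (z, t) \<in> {a, b}" "L (z, t + 1) \<in> {a, b}" "e \<in> {a, b}"
    unfolding ab[symmetric]
    using double_lift_facts(3,4)[OF L z] unwrap_shift_int[OF z, of "t + 1" t] e by auto
  then show ?thesis using double_lift_facts(5)[OF L z, of t] by auto
qed

lemma double_lift_period:
  assumes L: "double_lift E q L" and z: "z \<in> cball 0 1"
  shows "L (z, t + 2) = L (z, t)"
proof -
  have "L (z, t + 2) = L (z, t) \<or> L (z, t + 2) = L (z, t + 1)"
    using double_lift_facts(3,4)[OF L z] unwrap_shift_int[OF z, of "t + 2" t]
    by (intro double_lift_fibre[OF L z]) auto
  moreover have "L (z, (t + 1) + 1) \<noteq> L (z, t + 1)" by (rule double_lift_facts(5)[OF L z])
  ultimately show ?thesis by (simp add: add.assoc)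
qed

lemma double_lift_eq_iff:
  assumes L: "double_lift E q L" and z: "z \<in> cball 0 1"
  shows "L (z, s) = L (z, t) \<longleftrightarrow> (s - t) / 2 \<in> \<int>"
proof
  have even: "L (z, s) = L (z, t)" if "(s - t) / 2 \<in> \<int>" for s t
  proof -
    \<comment> \<open>Rescaling turns the period 2 into the period 1 of \<open>lift_period_int\<close>.\<close>
    define M where "M = (\<lambda>(w :: complex, r). L (w, 2 * r))"
    have per: "M (z, r + 1) = M (z, r)" for r
      using double_lift_period[OF L z, of "2 * r"] by (simp add: M_def algebra_simps)
    have st: "s / 2 - t / 2 \<in> \<int>" using that by (simp add: diff_divide_distrib)
    have "M (z, s / 2) = M (z, t / 2)" by (rule lift_period_int[OF per st])
    then show ?thesis by (simp add: M_def)
  qed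
  show "L (z, s) = L (z, t)" if "(s - t) / 2 \<in> \<int>" using that by (rule even)
  assume eq: "L (z, s) = L (z, t)"
  then have "unwrap (z, s) = unwrap (z, t)" using double_lift_facts(4)[OF L z] by metis
  then obtain k :: int where k: "s - t = of_int k" using unwrap_eq_iff[OF z] by (auto elim: Ints_cases)
  show "(s - t) / 2 \<in> \<int>"
  proof (cases "even k")
    case True
    then show ?thesis using k by (auto elim!: evenE)
  next
    case False
    then obtain n where "k = 2 * n + 1" by (auto elim: oddE)
    then have "(s - (t + 1)) / 2 = of_int n" using k by simp
    then have "L (z, s) = L (z, t + 1)" by (intro even) simp
    then show ?thesis using eq double_lift_facts(5)[OF L z, of t] by simp
  qed
qed

lemma double_lift_surj:
  assumes L: "double_lift E q L" and "e \<in> E"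
  obtains z t where "z \<in> cball 0 1" "L (z, t) = e"
proof -
  have "q e \<in> P"
    using covering_space_imp_surjective[OF double_lift_facts(1)[OF L]] assms(2) by auto
  then obtain z t where "z \<in> cball 0 1" "unwrap (z, t) = q e" by (rule unwrap_surj)
  then show ?thesis using double_lift_fibre[OF L, of z e t] assms(2) that by metis
qed

text \<open>
  Openness can be tested in a sheet \<open>T\<close>, on which \<open>q\<close> is an open embedding. The preimage of \<open>q ` C\<close> under
  \<open>unwrap\<close> consists of the points that \<open>L\<close> maps to \<open>C\<close> and of their translates by one turn; so
  the claim reduces to the quotient property of \<open>unwrap\<close>.
\<close>

lemma double_lift_quotient:
  assumes L: "double_lift E q L" and "B \<subseteq> E"
    and op: "openin (top_of_set (cball 0 1 \<times> UNIV)) {v \<in> cball 0 1 \<times> UNIV. L v \<in> B}"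
  shows "openin (top_of_set E) B"
proof (subst openin_subopen, intro ballI)
  let ?D = "cball 0 1 \<times> UNIV :: (complex \<times> real) set"
  note facts = double_lift_facts[OF L]
  fix e assume "e \<in> B"
  then have "e \<in> E" using assms(2) by auto
  then obtain T V \<sigma> where T: "e \<in> T" "openin (top_of_set E) T" "homeomorphism T V q \<sigma>"
    by (rule covering_space_local_homeomorphism[OF facts(1)])
  define C where "C = B \<inter> T"
  have C: "C \<subseteq> E" "inj_on q T" using assms(2) T(3) 
    by (auto simp: C_def homeomorphism_def intro: inj_on_inverseI)
  have q: "continuous_on E q" "q ` E = P"
    using facts(1) by (auto simp: covering_space_def)
  \<comment> \<open>\<open>A\<close> is the preimage of \<open>C\<close> under \<open>L\<close>, in a form that shows that it is open.\<close>
  define A where "A = {v \<in> ?D. L v \<in> B} \<inter> (?D \<inter> L -` T)"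
  have A: "openin (top_of_set ?D) A"
    unfolding A_def using op T(2) facts(2,3)
    by (intro openin_Int continuous_openin_preimage[where T=E]) auto
  have "openin (top_of_set ?D) (?D \<inter> (\<lambda>v. (fst v, snd v + 1)) -` A)"
    using A by (intro continuous_openin_preimage[where T="?D"] continuous_intros) auto
  then have "openin (top_of_set ?D) (A \<union> (?D \<inter> (\<lambda>v. (fst v, snd v + 1)) -` A))"
    using A by (intro openin_Un)
  also have "A \<union> (?D \<inter> (\<lambda>v. (fst v, snd v + 1)) -` A) = {v \<in> ?D. unwrap v \<in> q ` C}"
  proof (rule Set.set_eqI)
    fix v :: "complex \<times> real"
    obtain z t where v: "v = (z, t)" by (cases v)
    show "v \<in> A \<union> (?D \<inter> (\<lambda>v. (fst v, snd v + 1)) -` A) \<longleftrightarrow> v \<in> {v \<in> ?D. unwrap v \<in> q ` C}"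
    proof (cases "z \<in> cball 0 1")
      case True
      have "q (L (z, t)) = unwrap (z, t)" "q (L (z, t + 1)) = unwrap (z, t)"
        using facts(4)[OF True] unwrap_shift_int[OF True, of "t + 1" t] by auto
      then have "unwrap (z, t) \<in> q ` C \<longleftrightarrow> L (z, t) \<in> C \<or> L (z, t + 1) \<in> C"
        using double_lift_fibre[OF L True] C(1) by (metis image_iff subsetD)
      then show ?thesis using True by (auto simp: v A_def C_def)
    qed (auto simp: v A_def)
  qed
  finally have "openin (top_of_set P) (q ` C)"
    using C(1) q(2) by (intro unwrap_quotient) auto
  then have "openin (top_of_set E) (E \<inter> q -` (q ` C))"
    using q by (intro continuous_openin_preimage[where T=P]) auto
  with T(2) have "openin (top_of_set E) (T \<inter> (E \<inter> q -` (q ` C)))" by (rule openin_Int)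
  moreover have "T \<inter> (E \<inter> q -` (q ` C)) = C"
    using C by (auto simp: C_def inj_on_def)
  ultimately show "\<exists>W. openin (top_of_set E) W \<and> e \<in> W \<and> W \<subseteq> B"
    using \<open>e \<in> B\<close> T(1) by (intro exI[of _ C]) (auto simp: C_def)
qed

end

section \<open>Functions on the disc with prescribed jumps across the glued sides\<close>

text \<open>
  Polar coordinates present the disc as a quotient of a rectangle, and \<open>r * \<theta> s\<close> is compatible with the
  identifications: all angles are identified at the centre, and the two ends of the interval elsewhere.
\<close>

lemma radial_extension:
  fixes \<theta> :: "real \<Rightarrow> real"
  assumes "N > 0" "continuous_on {0..N} \<theta>" "\<theta> 0 = \<theta> N"
  obtains m where "continuous_on (cball (0::complex) 1) m"
    "\<And>s. s \<in> {0..N} \<Longrightarrow> m (cis (2 * pi * (s / N))) = \<theta> s"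
proof -
  define e where "e = (\<lambda>(s, r). of_real r * cis (2 * pi * (s / N)))"
  define h where "h = (\<lambda>(s, r). r * \<theta> s)"
  let ?R = "{0..N} \<times> {0..1::real}"
  have surj: "e ` ?R = cball 0 1"
  proof (intro Set.set_eqI iffI)
    fix z :: complex assume z: "z \<in> cball 0 1"
    define w where "w = (if z = 0 then 1 else sgn z)"
    have "w \<in> sphere 0 1" by (auto simp: w_def norm_sgn)
    then obtain t where t: "t \<in> {0..1}" "w = cis (2 * pi * t)" by (rule sphere_eq_cis)
    have "z = of_real (norm z) * w" by (auto simp: w_def sgn_eq)
    moreover have "e (N * t, norm z) = of_real (norm z) * w"
      unfolding t(2) using \<open>N > 0\<close> by (simp add: e_def mult.assoc)
    ultimately have "z = e (N * t, norm z)" by metis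
    moreover have "(N * t, norm z) \<in> ?R"
      using t(1) z \<open>N > 0\<close> by (auto simp: mult_left_le)
    ultimately show "z \<in> e ` ?R" by blast
  qed (auto simp: e_def norm_mult)
  have quot: "quotient_map (top_of_set ?R) (top_of_set (cball 0 1)) e"
  proof (rule T1_Spaces.continuous_imp_quotient_map)
    show "continuous_map (top_of_set ?R) (top_of_set (cball 0 1)) e"
      using surj \<open>N > 0\<close> by (auto simp: e_def split_def intro!: continuous_intros)
  qed (use surj in \<open>auto simp: compact_space_subtopology compact_Times Hausdorff_space_subtopology\<close>)
  have fibre_const: "h v = h v'" if v: "v \<in> ?R" "v' \<in> ?R" and eq: "e v = e v'" for v v'
  proof -
    obtain s r s' r' where [simp]: "v = (s, r)" "v' = (s', r')" by (cases v, cases v')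
    have "norm (e v) = norm (e v')" using eq by simp
    then have r: "r = r'" using v by (auto simp: e_def norm_mult)
    show ?thesis
    proof (cases "r = 0")
      case False
      then have "cis (2 * pi * (s / N)) = cis (2 * pi * (s' / N))"
        using eq r by (simp add: e_def)
      then have "s / N - s' / N \<in> \<int>" by (simp only: cis_2pi_eq_iff)
      then obtain k :: int where k: "s / N - s' / N = of_int k" by (rule Ints_cases)
      then have ss: "s = s' + N * of_int k" using \<open>N > 0\<close> by (simp add: field_simps)
      have "s / N \<in> {0..1}" "s' / N \<in> {0..1}" using v \<open>N > 0\<close> by auto
      then have "-1 \<le> (of_int k :: real)" "(of_int k :: real) \<le> 1" using k by auto
      then have "-1 \<le> k" "k \<le> 1" by linarith+
      then consider "k = 0" | "k = 1" | "k = -1" by linarith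
      then have "\<theta> s = \<theta> s'"
      proof cases
        case 2
        then have "s = N" "s' = 0" using ss v by auto
        then show ?thesis using assms(3) by simp
      next
        case 3
        then have "s' = N" "s = 0" using ss v by auto
        then show ?thesis using assms(3) by simp
      qed (use ss in simp)
      then show ?thesis using r by (simp add: h_def)
    qed (use r in \<open>simp add: h_def\<close>)
  qed
  have cont_h: "continuous_map (top_of_set ?R) euclidean h"
    by (auto simp: h_def split_def intro!: continuous_intros continuous_on_compose2[OF assms(2)])
  show ?thesis
  proof (rule quotient_map_lift_exists[OF quot cont_h])
    show "h v = h v'" if "v \<in> topspace (top_of_set ?R)" "v' \<in> topspace (top_of_set ?R)"
      "e v = e v'" for v v'
      using that by (intro fibre_const) (simp_all only: topspace_euclidean_subtopology)
    fix m assume m: "continuous_map (top_of_set (cball 0 1)) euclidean m"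
      "\<And>v. v \<in> topspace (top_of_set ?R) \<Longrightarrow> m (e v) = h v"
    show thesis
    proof (rule that)
      show "continuous_on (cball 0 1) m" using m(1) by simp
      show "m (cis (2 * pi * (s / N))) = \<theta> s" if "s \<in> {0..N}" for s
        using m(2)[of "(s, 1)"] that by (simp add: e_def h_def)
    qed
  qed
qed

text \<open>
  The tent rises from 0 to 1 on \<open>{a..a + 1}\<close>, stays 1 on \<open>{a + 1..a + 2}\<close>, and returns to 0 on \<open>{a + 2..a + 3}\<close>.
\<close>

definition tent :: "real \<Rightarrow> real \<Rightarrow> real" where
  "tent a s = max 0 (min 1 (min (s - a) (a + 3 - s)))"

text \<open>
  The four sides of the \<open>j\<close>-th handle occupy the parameters from \<open>4 * j\<close> to \<open>4 * j + 4\<close>, with side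
  \<open>4 * j + r\<close> glued backwards to side \<open>4 * j + r + 2\<close>. The tent from \<open>4 * j + 1\<close> to \<open>4 * j + 4\<close> takes
  equal values at glued points of the second pair, while on the first pair it is 0 on the earlier side and 1 on the
  later one. The tent from \<open>4 * j\<close> to \<open>4 * j + 3\<close> has the same two properties with the pairs exchanged, except
  that the jump is \<open>- 1\<close>. Integral combinations of these \<open>2 * g\<close> functions thus realize all jumps; they correspond
  to a basis of the first cohomology of the surface.
\<close>

lemma prescribed_jumps:
  assumes "g \<ge> 1"
  obtains m :: "complex \<Rightarrow> real" where "continuous_on (cball 0 1) m"
    "\<And>j r t. j < g \<Longrightarrow> r < 2 \<Longrightarrow> t \<in> {0..1} \<Longrightarrow>
       m (polygon_side g (4 * j + r + 2) (1 - t)) - m (polygon_side g (4 * j + r) t) = n (4 * j + r)"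
proof -
  define T where "T j s = n (4 * j) * tent (4 * real j + 1) s - n (4 * j + 1) * tent (4 * real j) s"
    for j s
  define \<theta> where "\<theta> s = (\<Sum>j<g. T j s)" for s
  \<comment> \<open>Only the handle to which \<open>s\<close> belongs contributes to \<open>\<theta> s\<close>.\<close>
  have T0: "T i s = 0" if "s \<le> 4 * real i \<or> s \<ge> 4 * real i + 4" for i s
    using that by (auto simp: T_def tent_def max_def min_def)
  have local: "\<theta> s = T j s" if j: "j < g" "4 * real j \<le> s" "s \<le> 4 * real j + 4" for j s
  proof -
    have "T i s = 0" if "i \<noteq> j" for i
    proof (rule T0)
      consider "i + 1 \<le> j" | "j + 1 \<le> i" using \<open>i \<noteq> j\<close> by linarith
      then show "s \<le> 4 * real i \<or> s \<ge> 4 * real i + 4"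
      proof cases
        case 1
        then have "real i + 1 \<le> real j" by linarith
        then show ?thesis using j by linarith
      next
        case 2
        then have "real j + 1 \<le> real i" by linarith
        then show ?thesis using j by linarith
      qed
    qed
    then have "\<theta> s = (\<Sum>i\<in>{j}. T i s)"
      unfolding \<theta>_def using j(1) by (intro sum.mono_neutral_right) auto
    then show ?thesis by simp
  qed
  have "continuous_on {0..4 * real g} \<theta>"
    unfolding \<theta>_def T_def tent_def by (intro continuous_intros)
  moreover have "\<theta> 0 = \<theta> (4 * real g)"
  proof -
    have "\<theta> 0 = 0" unfolding \<theta>_def by (intro sum.neutral ballI T0) simp
    moreover have "\<theta> (4 * real g) = 0" unfolding \<theta>_def by (intro sum.neutral ballI T0) auto
    ultimately show ?thesis by simp
  qed
  ultimately obtain m where m: "continuous_on (cball 0 1) m"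
    "\<And>s. s \<in> {0..4 * real g} \<Longrightarrow> m (cis (2 * pi * (s / (4 * real g)))) = \<theta> s"
    using assms by (auto intro: radial_extension[of "4 * real g" \<theta>])
  have side: "m (polygon_side g (4 * j + r) t) = T j (4 * real j + real r + t)"
    if "j < g" "r < 4" "t \<in> {0..1}" for j r t
  proof -
    have "real j + 1 \<le> real g" "real r + 1 \<le> 4" using that by linarith+
    then have "4 * real j + real r + t \<in> {0..4 * real g}" "4 * real j + real r + t \<le> 4 * real j + 4"
      using that by auto
    then show ?thesis
      using m(2)[of "4 * real j + real r + t"] local[OF that(1), of "4 * real j + real r + t"] that
      by (simp add: polygon_side_def)
  qed
  show ?thesis
  proof (rule that[OF m(1)])
    fix j r :: nat and t :: real assume jrt: "j < g" "r < 2" "t \<in> {0..1}"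
    have "T j (4 * real j + real (r + 2) + (1 - t)) - T j (4 * real j + real r + t) = n (4 * j + r)"
    proof (cases "r = 0")
      case True
      then show ?thesis using jrt by (auto simp: T_def tent_def max_def min_def algebra_simps)
    next
      case False
      then have "r = 1" using jrt by simp
      then show ?thesis using jrt by (auto simp: T_def tent_def max_def min_def algebra_simps)
    qed
    then show "m (polygon_side g (4 * j + r + 2) (1 - t)) - m (polygon_side g (4 * j + r) t) =
        n (4 * j + r)"
      using side[of j "r + 2" "1 - t"] side[of j r t] jrt by (simp add: add.assoc)
  qed
qed

context trivialized_cell begin

text \<open>
  Points of \<open>K\<close> over identified points of the disc differ by an element of the circle that depends
  continuously on the position on the side, and \<open>c\<close> is an angle for it.
\<close>

lemma unwrap_transition:
  assumes \<beta>: "continuous_on {0..1} \<beta>" "continuous_on {0..1} \<beta>'"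
    "\<And>s. s \<in> {0..1::real} \<Longrightarrow> \<beta> s \<in> cball 0 1 \<and> \<beta>' s \<in> cball 0 1 \<and> \<kappa> (\<beta> s) = \<kappa> (\<beta>' s)"
  obtains c where "continuous_on {0..1} c"
    "\<And>s t. s \<in> {0..1} \<Longrightarrow> unwrap (\<beta> s, t) = unwrap (\<beta>' s, c s + t)"
proof -
  obtain d where d: "continuous_on {(x, y). x \<in> P \<and> y \<in> P \<and> p x = p y} d"
    "\<And>x y. x \<in> P \<Longrightarrow> y \<in> P \<Longrightarrow> p x = p y \<Longrightarrow> d (x, y) \<in> sphere 0 1 \<and> act x (d (x, y)) = y"
    by (rule principal_circle_bundle_division[OF principal]) (rule that)
  have K\<beta>: "K (\<beta> s) \<in> P" "K (\<beta>' s) \<in> P" "p (K (\<beta>' s)) = p (K (\<beta> s))" if "s \<in> {0..1}" for s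
    using \<beta>(3)[OF that] K_in p_K by auto
  define w where "w s = d (K (\<beta>' s), K (\<beta> s))" for s
  have w: "w s \<in> sphere 0 1" "act (K (\<beta>' s)) (w s) = K (\<beta> s)" if "s \<in> {0..1}" for s
    using d(2) K\<beta>[OF that] by (auto simp: w_def)
  have cw: "continuous_on {0..1} w" unfolding w_def
  proof (rule continuous_on_compose2[OF d(1)])
    show "continuous_on {0..1} (\<lambda>s. (K (\<beta>' s), K (\<beta> s)))"
    proof (rule continuous_on_Pair)
      show "continuous_on {0..1} (\<lambda>s. K (\<beta>' s))" "continuous_on {0..1} (\<lambda>s. K (\<beta> s))"
        by (rule continuous_on_compose2[OF cont_K \<beta>(2)] continuous_on_compose2[OF cont_K \<beta>(1)];
            use \<beta>(3) in blast)+
    qed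
  qed (use K\<beta> in auto)
  have iw: "w ` {0..1} \<subseteq> sphere 0 1" using w by blast
  obtain c where c: "continuous_on {0..1} c" "\<And>s. s \<in> {0..1} \<Longrightarrow> w s = cis (2 * pi * c s)"
    by (rule circle_valued_angle[OF _ _ cw iw, of 0]) (auto simp: closed_segment_eq_real_ivl)
  show ?thesis
  proof (rule that[OF c(1)])
    fix s t :: real assume s: "s \<in> {0..1}"
    have "K (\<beta> s) = unwrap (\<beta>' s, c s)" using w(2)[OF s] c(2)[OF s] by (simp add: unwrap_def)
    then have "unwrap (\<beta> s, t) = act (unwrap (\<beta>' s, c s)) (cis (2 * pi * t))"
      by (simp add: unwrap_def)
    then show "unwrap (\<beta> s, t) = unwrap (\<beta>' s, c s + t)" using act_unwrap \<beta>(3)[OF s] by simp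
  qed
qed

text \<open>
  Both sides lift the same map on the connected strip \<open>{0..1} \<times> \<real>\<close>, so \<open>n\<close> can be fixed at one point, where
  the two points of the fibre of the covering differ by one turn.
\<close>

lemma lift_transition:
  assumes L: "double_lift E q L"
    and \<beta>: "continuous_on {0..1} \<beta>" "continuous_on {0..1} \<beta>'"
    "\<And>s. s \<in> {0..1::real} \<Longrightarrow> \<beta> s \<in> cball 0 1 \<and> \<beta>' s \<in> cball 0 1"
    and c: "continuous_on {0..1} c"
    "\<And>s t. s \<in> {0..1} \<Longrightarrow> unwrap (\<beta> s, t) = unwrap (\<beta>' s, c s + t)"
  obtains n :: int where
    "\<And>s t. s \<in> {0..1} \<Longrightarrow> L (\<beta> s, t) = L (\<beta>' s, c s + of_int n + t)"
proof -
  note facts = double_lift_facts[OF L]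
  have 0: "\<beta> 0 \<in> cball 0 1" "\<beta>' 0 \<in> cball 0 1" using \<beta>(3)[of 0] by auto
  have "L (\<beta> 0, 0) = L (\<beta>' 0, c 0) \<or> L (\<beta> 0, 0) = L (\<beta>' 0, c 0 + 1)"
    using facts(3,4)[OF 0(1)] c(2)[of 0 0] by (intro double_lift_fibre[OF L 0(2)]) auto
  then obtain n :: int where n: "L (\<beta> 0, 0) = L (\<beta>' 0, c 0 + of_int n)"
    by (metis add.right_neutral of_int_0 of_int_1)
  show ?thesis
  proof
    fix s t :: real assume s: "s \<in> {0..1}"
    have "L (\<beta> (fst (s, t)), snd (s, t)) = L (\<beta>' (fst (s, t)), c (fst (s, t)) + of_int n + snd (s, t))"
    proof (rule covering_space_lifts_agree[OF facts(1), of "{0..1} \<times> UNIV"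
          "\<lambda>v. L (\<beta> (fst v), snd v)" "\<lambda>v. L (\<beta>' (fst v), c (fst v) + of_int n + snd v)" "(0, 0)"])
      show "connected ({0..1::real} \<times> (UNIV :: real set))"
        by (intro convex_connected convex_Times) auto
      show "continuous_on ({0..1} \<times> UNIV) (\<lambda>v. L (\<beta> (fst v), snd v))"
        using \<beta> by (intro continuous_on_compose2[OF facts(2)] continuous_intros
            continuous_on_compose2[OF \<beta>(1)]) auto
      show "continuous_on ({0..1} \<times> UNIV) (\<lambda>v. L (\<beta>' (fst v), c (fst v) + of_int n + snd v))"
        using \<beta> by (intro continuous_on_compose2[OF facts(2)] continuous_intros
            continuous_on_compose2[OF \<beta>(2)] continuous_on_compose2[OF c(1)]) auto
      show "q (L (\<beta> (fst v), snd v)) = q (L (\<beta>' (fst v), c (fst v) + of_int n + snd v))"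
        if "v \<in> {0..1} \<times> UNIV" for v
      proof -
        have v: "fst v \<in> {0..1}" using that by auto
        show ?thesis
          using facts(4) \<beta>(3)[OF v] c(2)[OF v, of "snd v"]
            unwrap_shift_int[of "\<beta>' (fst v)" "c (fst v) + of_int n + snd v" "c (fst v) + snd v"]
          by simp
      qed
    qed (use \<beta>(3) facts(3) n s in auto)
    then show "L (\<beta> s, t) = L (\<beta>' s, c s + of_int n + t)" by simp
  qed
qed

end

section \<open>Comparing two special coverings\<close>

lemma polygon_side_in: "polygon_side g k t \<in> cball 0 1"
  by (simp add: polygon_side_def)

lemma continuous_on_polygon_side:
  "continuous_on S f \<Longrightarrow> continuous_on S (\<lambda>s. polygon_side g k (f s))"
  unfolding polygon_side_def by (cases "g = 0") (auto intro!: continuous_intros)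

text \<open>
  Both families of gluings treated alike: in every handle, side \<open>r\<close> is glued to side \<open>r + 2\<close> for \<open>r < 2\<close>.
\<close>

lemma polygon_glue_iff:
  "polygon_glue g z w \<longleftrightarrow> (\<exists>j<g. \<exists>r<2. \<exists>t\<in>{0..1}.
     z = polygon_side g (4 * j + r) t \<and> w = polygon_side g (4 * j + r + 2) (1 - t))"
proof
  assume "polygon_glue g z w"
  then show "\<exists>j<g. \<exists>r<2. \<exists>t\<in>{0..1}.
     z = polygon_side g (4 * j + r) t \<and> w = polygon_side g (4 * j + r + 2) (1 - t)"
  proof cases
    case (glue_a j t)
    then show ?thesis by (intro exI[of _ j] exI[of _ 0] conjI bexI[of _ t]) auto
  next
    case (glue_b j t)
    then show ?thesis
      by (intro exI[of _ j] exI[of _ 1] conjI bexI[of _ t]) (auto simp: numeral_3_eq_3)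
  qed
next
  assume "\<exists>j<g. \<exists>r<2. \<exists>t\<in>{0..1}.
     z = polygon_side g (4 * j + r) t \<and> w = polygon_side g (4 * j + r + 2) (1 - t)"
  then obtain j r t where jrt: "j < g" "r < 2" "t \<in> {0..1}"
    and zw: "z = polygon_side g (4 * j + r) t" "w = polygon_side g (4 * j + r + 2) (1 - t)" by blast
  have "r = 0 \<or> r = 1" using jrt(2) by auto
  then show "polygon_glue g z w"
  proof
    assume "r = 0"
    then show ?thesis using polygon_glue.glue_a[OF jrt(1,3)] zw by simp
  next
    assume "r = 1"
    then show ?thesis using polygon_glue.glue_b[OF jrt(1,3)] zw by (simp add: numeral_3_eq_3)
  qed
qed

context trivialized_cell begin

lemma lifts_differ_by_jumps:
  assumes L: "double_lift E q L" and M: "double_lift E' q' M"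
    and \<beta>: "continuous_on {0..1} \<beta>" "continuous_on {0..1} \<beta>'"
    "\<And>s. s \<in> {0..1::real} \<Longrightarrow> \<beta> s \<in> cball 0 1 \<and> \<beta>' s \<in> cball 0 1 \<and> \<kappa> (\<beta> s) = \<kappa> (\<beta>' s)"
  shows "\<exists>n::int. \<forall>s\<in>{0..1}. \<exists>c. \<forall>t.
    L (\<beta> s, t) = L (\<beta>' s, c + t) \<and> M (\<beta> s, t) = M (\<beta>' s, c + t + of_int n)"
proof -
  obtain c where c: "continuous_on {0..1} c"
    "\<And>s t. s \<in> {0..1} \<Longrightarrow> unwrap (\<beta> s, t) = unwrap (\<beta>' s, c s + t)"
    by (rule unwrap_transition[OF \<beta>]) (assumption | rule that)+
  have \<beta>c: "\<beta> s \<in> cball 0 1 \<and> \<beta>' s \<in> cball 0 1" if "s \<in> {0..1}" for s using \<beta>(3)[OF that] by simp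
  obtain l where l: "\<And>s t. s \<in> {0..1} \<Longrightarrow> L (\<beta> s, t) = L (\<beta>' s, c s + of_int l + t)"
    by (rule lift_transition[OF L \<beta>(1,2) \<beta>c c]) (assumption | rule that)+
  obtain k where k: "\<And>s t. s \<in> {0..1} \<Longrightarrow> M (\<beta> s, t) = M (\<beta>' s, c s + of_int k + t)"
    by (rule lift_transition[OF M \<beta>(1,2) \<beta>c c]) (assumption | rule that)+
  \<comment> \<open>The common offset of \<open>L\<close> is absorbed into \<open>c\<close>; the relative offset remains.\<close>
  show ?thesis
  proof (intro exI[of _ "k - l"] ballI)
    fix s :: real assume s: "s \<in> {0..1}"
    show "\<exists>c. \<forall>t. L (\<beta> s, t) = L (\<beta>' s, c + t) \<and> M (\<beta> s, t) = M (\<beta>' s, c + t + of_int (k - l))"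
      using l[OF s] k[OF s] by (intro exI[of _ "c s + of_int l"]) (simp add: algebra_simps)
  qed
qed

text \<open>
  The property demanded of glued points is an equivalence relation, so it only has to be checked for
  corresponding points on two sides. There, \<open>m\<close> is made to jump by the integer by which \<open>M\<close> deviates from \<open>L\<close>. Only
  differences of values of \<open>m\<close> matter, so \<open>m\<close> can be normalized at any given point.
\<close>

lemma compatible_shift:
  assumes L: "double_lift E q L" and M: "double_lift E' q' M" and "g \<ge> 1"
    and glue: "\<And>z w. z \<in> cball 0 1 \<Longrightarrow> w \<in> cball 0 1 \<Longrightarrow> \<kappa> z = \<kappa> w \<longleftrightarrow> equivclp (polygon_glue g) z w"
  obtains m :: "complex \<Rightarrow> real" where "continuous_on (cball 0 1) m" "m z\<^sub>0 = 0"
    "\<And>z w. z \<in> cball 0 1 \<Longrightarrow> w \<in> cball 0 1 \<Longrightarrow> \<kappa> z = \<kappa> w \<Longrightarrow> m z - m w \<in> \<int> \<and>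
       (\<exists>c. \<forall>t. L (z, t) = L (w, c + t) \<and> M (z, t + m z) = M (w, c + t + m w))"
proof -
  define sides where "sides = {k. \<exists>j<g. \<exists>r<2. k = 4 * j + r}"
  define R where "R k n \<longleftrightarrow> (\<forall>s\<in>{0..1}. \<exists>c. \<forall>t.
      L (polygon_side g k s, t) = L (polygon_side g (k + 2) (1 - s), c + t) \<and>
      M (polygon_side g k s, t) = M (polygon_side g (k + 2) (1 - s), c + t + of_int n))"
    for k and n :: int
  have "\<exists>n. R k n" if "k \<in> sides" for k
    unfolding R_def
  proof (rule lifts_differ_by_jumps[OF L M])
    fix s :: real assume s: "s \<in> {0..1}"
    have "polygon_glue g (polygon_side g k s) (polygon_side g (k + 2) (1 - s))"
      unfolding polygon_glue_iff using that s unfolding sides_def by blast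
    then have "\<kappa> (polygon_side g k s) = \<kappa> (polygon_side g (k + 2) (1 - s))"
      using glue[OF polygon_side_in polygon_side_in] by (simp add: r_into_equivclp)
    then show "polygon_side g k s \<in> cball 0 1 \<and> polygon_side g (k + 2) (1 - s) \<in> cball 0 1 \<and>
        \<kappa> (polygon_side g k s) = \<kappa> (polygon_side g (k + 2) (1 - s))"
      using polygon_side_in by simp
  qed (intro continuous_on_polygon_side continuous_intros)+
  then obtain n where n: "\<And>k. k \<in> sides \<Longrightarrow> R k (n k)" by metis
  obtain m' :: "complex \<Rightarrow> real" where m': "continuous_on (cball 0 1) m'"
    "\<And>j r t. j < g \<Longrightarrow> r < 2 \<Longrightarrow> t \<in> {0..1} \<Longrightarrow>
       m' (polygon_side g (4 * j + r + 2) (1 - t)) - m' (polygon_side g (4 * j + r) t)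
       = of_int (n (4 * j + r))"
    by (rule prescribed_jumps[OF \<open>g \<ge> 1\<close>, where n = "\<lambda>k. of_int (n k)"]) (assumption | rule that)+
  define m where "m z = m' z - m' z\<^sub>0" for z
  define rel where "rel z w \<longleftrightarrow> m z - m w \<in> \<int> \<and>
      (\<exists>c. \<forall>t. L (z, t) = L (w, c + t) \<and> M (z, t + m z) = M (w, c + t + m w))" for z w
  have rel_glue: "rel z w" if zw_glue: "polygon_glue g z w" for z w
  proof -
    obtain j r s where jrs: "j < g" "r < 2" "s \<in> {0..1}"
      and zw: "z = polygon_side g (4 * j + r) s" "w = polygon_side g (4 * j + r + 2) (1 - s)"
      using zw_glue unfolding polygon_glue_iff by blast
    define N where "N = n (4 * j + r)"
    have jump: "m w = m z + of_int N" using m'(2)[OF jrs] by (simp add: m_def zw N_def)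
    have "4 * j + r \<in> sides" using jrs by (auto simp: sides_def)
    from n[OF this] jrs(3) obtain c where
      c: "\<And>t. L (z, t) = L (w, c + t)" "\<And>t. M (z, t) = M (w, c + t + of_int N)"
      unfolding R_def zw N_def by blast
    have "M (z, t + m z) = M (w, c + t + m w)" for t
      using c(2)[of "t + m z"] by (simp add: jump add.assoc)
    then show ?thesis using c(1) jump by (auto simp: rel_def)
  qed
  have rel_sym: "rel w z" if zw: "rel z w" for z w
  proof -
    obtain c where c: "\<And>t. L (z, t) = L (w, c + t)" "\<And>t. M (z, t + m z) = M (w, c + t + m w)"
      using zw by (auto simp: rel_def)
    have "L (w, t) = L (z, - c + t)" "M (w, t + m w) = M (z, - c + t + m z)" for t
      using c[of "- c + t"] by simp_all
    moreover have "m w - m z \<in> \<int>"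
      using zw Ints_minus[of "m z - m w"] by (simp add: rel_def)
    ultimately show ?thesis unfolding rel_def by blast
  qed
  have rel_trans: "rel z w" if zy: "rel z y" and yw: "rel y w" for z y w
  proof -
    obtain c where c: "\<And>t. L (z, t) = L (y, c + t)" "\<And>t. M (z, t + m z) = M (y, c + t + m y)"
      using zy by (auto simp: rel_def)
    obtain d where d: "\<And>t. L (y, t) = L (w, d + t)" "\<And>t. M (y, t + m y) = M (w, d + t + m w)"
      using yw by (auto simp: rel_def)
    have "L (z, t) = L (w, d + c + t)" "M (z, t + m z) = M (w, d + c + t + m w)" for t
      using c[of t] d[of "c + t"] by (simp_all add: add.assoc)
    moreover have "m z - m w \<in> \<int>"
      using zy yw Ints_add[of "m z - m y" "m y - m w"] by (simp add: rel_def)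
    ultimately show ?thesis unfolding rel_def by blast
  qed
  have rel_refl: "rel z z" for z
    unfolding rel_def by (intro conjI exI[of _ 0]) auto
  have rel: "rel z w" if "equivclp (polygon_glue g) z w" for z w
    using that
  proof (induction rule: equivclp_induct)
    case (step y w)
    then show ?case using rel_glue rel_sym rel_trans by metis
  qed (rule rel_refl)
  show ?thesis
  proof (rule that)
    show "continuous_on (cball 0 1) m" unfolding m_def by (intro continuous_intros m')
    show "m z\<^sub>0 = 0" by (simp add: m_def)
    fix z w :: complex assume zw: "z \<in> cball 0 1" "w \<in> cball 0 1" "\<kappa> z = \<kappa> w"
    then have "rel z w" using glue rel by metis
    then show "m z - m w \<in> \<int> \<and>
       (\<exists>c. \<forall>t. L (z, t) = L (w, c + t) \<and> M (z, t + m z) = M (w, c + t + m w))"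
      by (simp only: rel_def)
  qed
qed

text \<open>
  Integral differences of \<open>m\<close> at identified points let \<open>cis (2 * pi * m)\<close> descend to the base.
\<close>

lemma gauge_transformation:
  assumes m: "continuous_on (cball 0 1) m"
    "\<And>z w. z \<in> cball 0 1 \<Longrightarrow> w \<in> cball 0 1 \<Longrightarrow> \<kappa> z = \<kappa> w \<Longrightarrow> m z - m w \<in> \<int>"
  obtains R where "continuous_on P R" "R ` P \<subseteq> P"
    "\<And>z t. z \<in> cball 0 1 \<Longrightarrow> R (unwrap (z, t)) = unwrap (z, t + m z)"
proof -
  have h: "continuous_map (top_of_set (cball 0 1)) (top_of_set (sphere 0 1)) (\<lambda>z. cis (2 * pi * m z))"
    using m(1) by (auto intro!: continuous_intros)
  show ?thesis
  proof (rule quotient_map_lift_exists[OF quotient_cell h])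
    show "cis (2 * pi * m z) = cis (2 * pi * m w)"
      if "z \<in> topspace (top_of_set (cball 0 1))" "w \<in> topspace (top_of_set (cball 0 1))" "\<kappa> z = \<kappa> w"
      for z w
      unfolding cis_2pi_eq_iff using that by (intro m(2)) (simp_all only: topspace_euclidean_subtopology)
    fix f assume "continuous_map (top_of_set F) (top_of_set (sphere 0 1)) f"
      and f_top: "\<And>z. z \<in> topspace (top_of_set (cball 0 1)) \<Longrightarrow> f (\<kappa> z) = cis (2 * pi * m z)"
    then have f: "continuous_on F f" "f ` F \<subseteq> sphere 0 1"
      by (auto simp: continuous_map_in_subtopology)
    have f\<kappa>: "f (\<kappa> z) = cis (2 * pi * m z)" if "z \<in> cball 0 1" for z
      using that f_top by (simp only: topspace_euclidean_subtopology)
    have pF: "p y \<in> F" if "y \<in> P" for y using that bundle_facts(2) by auto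
    have fp: "f (p y) \<in> sphere 0 1" if "y \<in> P" for y using f(2) pF[OF that] by blast
    show thesis
    proof (rule that)
      show "continuous_on P (\<lambda>y. act y (f (p y)))"
      proof (rule continuous_on_act)
        show "continuous_on P (\<lambda>y. f (p y))"
          by (rule continuous_on_compose2[OF f(1) bundle_facts(1)]) (use pF in auto)
      qed (use fp in \<open>auto intro: continuous_on_id\<close>)
      show "(\<lambda>y. act y (f (p y))) ` P \<subseteq> P" using bundle_facts(4) fp by blast
      show "act (unwrap (z, t)) (f (p (unwrap (z, t)))) = unwrap (z, t + m z)"
        if "z \<in> cball 0 1" for z t
        by (simp only: p_unwrap[OF that] f\<kappa>[OF that] act_unwrap[OF that])
    qed
  qed
qed

text \<open>
  The map sending \<open>L (z, t)\<close> to \<open>M (z, t + m z)\<close> is well defined: if \<open>L (z, t) = L (w, s)\<close>, then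
  \<open>z\<close> and \<open>w\<close> are identified, and \<open>s\<close> differs from \<open>c + t\<close> by a period of \<open>L\<close>, which is also one of \<open>M\<close>. It is
  continuous because \<open>L\<close> is a quotient map, and injective on fibres because one turn exchanges the two points
  of a fibre in both coverings.
\<close>

lemma double_lift_map:
  assumes L: "double_lift E q L" and M: "double_lift E' q' M"
    and m: "continuous_on (cball 0 1) m"
    "\<And>z w. z \<in> cball 0 1 \<Longrightarrow> w \<in> cball 0 1 \<Longrightarrow> \<kappa> z = \<kappa> w \<Longrightarrow>
       \<exists>c. \<forall>t. L (z, t) = L (w, c + t) \<and> M (z, t + m z) = M (w, c + t + m w)"
    and R: "\<And>z t. z \<in> cball 0 1 \<Longrightarrow> R (unwrap (z, t)) = unwrap (z, t + m z)"
  obtains \<Psi> where "continuous_on E \<Psi>" "\<Psi> ` E \<subseteq> E'" "\<And>e. e \<in> E \<Longrightarrow> q' (\<Psi> e) = R (q e)"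
    "\<And>e e'. e \<in> E \<Longrightarrow> e' \<in> E \<Longrightarrow> q e = q e' \<Longrightarrow> \<Psi> e = \<Psi> e' \<Longrightarrow> e = e'"
proof -
  let ?D = "cball 0 1 \<times> UNIV :: (complex \<times> real) set"
  note Lf = double_lift_facts[OF L] and Mf = double_lift_facts[OF M]
  define N where "N v = M (fst v, snd v + m (fst v))" for v
  define \<Psi> where "\<Psi> e = N (SOME v. v \<in> ?D \<and> L v = e)" for e
  have wd: "N (z, t) = N (w, s)" if zw: "z \<in> cball 0 1" "w \<in> cball 0 1" and eq: "L (z, t) = L (w, s)"
    for z w t s
  proof -
    have "unwrap (z, t) = unwrap (w, s)" using Lf(4) zw eq by metis
    then have "\<kappa> z = \<kappa> w" using p_unwrap zw by metis
    then obtain c where c: "\<And>t. L (z, t) = L (w, c + t)" "\<And>t. M (z, t + m z) = M (w, c + t + m w)"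
      using m(2)[OF zw] by blast
    have "L (w, c + t) = L (w, s)" using eq c(1) by simp
    then have "((c + t) - s) / 2 \<in> \<int>" by (simp only: double_lift_eq_iff[OF L zw(2)])
    then have "M (w, c + t + m w) = M (w, s + m w)" by (simp add: double_lift_eq_iff[OF M zw(2)])
    then show ?thesis using c(2) by (simp add: N_def)
  qed
  have \<Psi>L: "\<Psi> (L (z, t)) = N (z, t)" if z: "z \<in> cball 0 1" for z t
  proof -
    have "\<exists>v. v \<in> ?D \<and> L v = L (z, t)" using z by blast
    then have *: "(SOME v. v \<in> ?D \<and> L v = L (z, t)) \<in> ?D \<and> L (SOME v. v \<in> ?D \<and> L v = L (z, t)) = L (z, t)"
      by (rule someI_ex)
    obtain w s where ws: "(SOME v. v \<in> ?D \<and> L v = L (z, t)) = (w, s)" by fastforce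
    then show ?thesis using * wd[OF _ z, of w s t] by (simp add: \<Psi>_def)
  qed
  have N: "N (z, t) \<in> E'" "q' (N (z, t)) = R (unwrap (z, t))" if "z \<in> cball 0 1" for z t
    using Mf(3,4)[OF that] R[OF that] by (auto simp: N_def)
  have contN: "continuous_on ?D N"
    unfolding N_def
  proof (rule continuous_on_compose2[OF Mf(2)])
    show "continuous_on ?D (\<lambda>v. (fst v, snd v + m (fst v)))"
      by (intro continuous_intros continuous_on_compose2[OF m(1)]) auto
  qed auto
  have im: "\<Psi> ` E \<subseteq> E'"
  proof (rule image_subsetI)
    fix e assume "e \<in> E"
    then obtain z t where "z \<in> cball 0 1" "L (z, t) = e" by (rule double_lift_surj[OF L])
    then show "\<Psi> e \<in> E'" using \<Psi>L N by metis
  qed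
  show ?thesis
  proof (rule that)
    show "continuous_on E \<Psi>"
    proof (subst continuous_on_open_gen)
      show "\<Psi> \<in> E \<rightarrow> E'" using im by auto
      show "\<forall>W. openin (top_of_set E') W \<longrightarrow> openin (top_of_set E) (E \<inter> \<Psi> -` W)"
      proof (intro allI impI)
        fix W assume W: "openin (top_of_set E') W"
        have "openin (top_of_set ?D) (?D \<inter> N -` W)"
          using contN _ W by (rule continuous_openin_preimage) (use N in auto)
        also have "?D \<inter> N -` W = {v \<in> ?D. L v \<in> E \<inter> \<Psi> -` W}"
          using \<Psi>L Lf(3) by auto
        finally show "openin (top_of_set E) (E \<inter> \<Psi> -` W)"
          by (intro double_lift_quotient[OF L]) auto
      qed
    qed
    show "\<Psi> ` E \<subseteq> E'" by (rule im)
    show "q' (\<Psi> e) = R (q e)" if e: "e \<in> E" for e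
    proof -
      obtain z t where "z \<in> cball 0 1" "L (z, t) = e" using e by (rule double_lift_surj[OF L])
      then show ?thesis using \<Psi>L N(2) Lf(4) by metis
    qed
    show "e = e'" if e: "e \<in> E" "e' \<in> E" "q e = q e'" "\<Psi> e = \<Psi> e'" for e e'
    proof -
      obtain z t where zt: "z \<in> cball 0 1" "L (z, t) = e" using e(1) by (rule double_lift_surj[OF L])
      then have "q e' = unwrap (z, t)" using Lf(4) e(3) by metis
      then consider "e' = L (z, t)" | "e' = L (z, t + 1)"
        using double_lift_fibre[OF L zt(1) e(2)] by blast
      then show ?thesis
      proof cases
        case 2
        then have "N (z, t) = N (z, t + 1)" using e(4) zt \<Psi>L by metis
        then have "M (z, (t + m z) + 1) = M (z, t + m z)" by (simp add: N_def algebra_simps)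
        then show ?thesis using Mf(5)[OF zt(1)] by blast
      qed (use zt in simp)
    qed
  qed
qed

end

section \<open>Induced maps and monodromy\<close>

lemma based_loop_image:
  assumes "\<alpha> \<in> based_loops X x" "continuous_on X f" "f ` X \<subseteq> Y"
  shows "f \<circ> \<alpha> \<in> based_loops Y (f x)"
  using assms path_continuous_image[of \<alpha> f]
  by (auto simp: based_loops_def path_image_compose pathstart_compose pathfinish_compose
      intro: continuous_on_subset)

lemma fundamental_map_hom:
  assumes "continuous_on X f" "f ` X \<subseteq> Y"
  shows "fundamental_map Y f \<in> hom (fundamental_group X x) (fundamental_group Y (f x))"
proof (rule homI)
  fix A assume "A \<in> carrier (fundamental_group X x)"
  then obtain \<alpha> where \<alpha>: "\<alpha> \<in> based_loops X x" "A = path_class X \<alpha>"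
    by (auto simp: fundamental_group_def)
  then show "fundamental_map Y f A \<in> carrier (fundamental_group Y (f x))"
    using fundamental_map_path_class[OF \<alpha>(1) assms] based_loop_image[OF \<alpha>(1) assms]
    by (auto simp: fundamental_group_def)
  fix B assume "B \<in> carrier (fundamental_group X x)"
  then obtain \<beta> where \<beta>: "\<beta> \<in> based_loops X x" "B = path_class X \<beta>"
    by (auto simp: fundamental_group_def)
  show "fundamental_map Y f (A \<otimes>\<^bsub>fundamental_group X x\<^esub> B) =
      fundamental_map Y f A \<otimes>\<^bsub>fundamental_group Y (f x)\<^esub> fundamental_map Y f B"
    unfolding \<alpha>(2) \<beta>(2) fundamental_group_mult[OF \<alpha>(1) \<beta>(1)]
      fundamental_map_path_class[OF based_loops_join[OF \<alpha>(1) \<beta>(1)] assms]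
      fundamental_map_path_class[OF \<alpha>(1) assms] fundamental_map_path_class[OF \<beta>(1) assms]
      fundamental_group_mult[OF based_loop_image[OF \<alpha>(1) assms] based_loop_image[OF \<beta>(1) assms]]
    by (simp add: path_compose_join)
qed

lemma fundamental_map_iso:
  assumes "continuous_on X f" "f ` X \<subseteq> X" "continuous_on X f'" "f' ` X \<subseteq> X"
    and inv: "\<And>y. y \<in> X \<Longrightarrow> f' (f y) = y" "\<And>y. y \<in> X \<Longrightarrow> f (f' y) = y"
    and base: "f x = x" "f' x = x"
  shows "fundamental_map X f \<in> iso (fundamental_group X x) (fundamental_group X x)"
proof -
  let ?G = "fundamental_group X x"
  have hom: "fundamental_map X f \<in> hom ?G ?G" "fundamental_map X f' \<in> hom ?G ?G"
    using fundamental_map_hom[OF assms(1,2), of x] fundamental_map_hom[OF assms(3,4), of x] base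
    by simp_all
  have inverse: "fundamental_map X k (fundamental_map X h A) = A"
    if A: "A \<in> carrier ?G" and h: "continuous_on X h" "h ` X \<subseteq> X" "h x = x"
      and k: "continuous_on X k" "k ` X \<subseteq> X" "\<And>y. y \<in> X \<Longrightarrow> k (h y) = y" for A h k
  proof -
    obtain \<alpha> where \<alpha>: "\<alpha> \<in> based_loops X x" "A = path_class X \<alpha>"
      using A by (auto simp: fundamental_group_def)
    have "fundamental_map X k (fundamental_map X h A) = path_class X (k \<circ> (h \<circ> \<alpha>))"
      using fundamental_map_path_class[OF \<alpha>(1) h(1,2)]
        fundamental_map_path_class[OF based_loop_image[OF \<alpha>(1) h(1,2)] k(1,2)] \<alpha>(2) by simp
    also have "\<dots> = path_class X \<alpha>"
    proof (rule path_class_eq, rule homotopic_paths_sym, rule homotopic_paths_eq)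
      show "path \<alpha>" "path_image \<alpha> \<subseteq> X" using \<alpha>(1) by (auto simp: based_loops_def)
      then show "\<alpha> t = (k \<circ> (h \<circ> \<alpha>)) t" if "t \<in> {0..1}" for t
        using that k(3)[of "\<alpha> t"] by (auto simp: path_image_def image_subset_iff)
    qed
    finally show ?thesis using \<alpha>(2) by simp
  qed
  have "bij_betw (fundamental_map X f) (carrier ?G) (carrier ?G)"
    by (rule bij_betwI[of _ _ _ "fundamental_map X f'"])
       (use hom inverse assms in \<open>auto simp: hom_def\<close>)
  then show ?thesis using hom(1) by (simp add: iso_def)
qed

text \<open>
  If \<open>\<eta>\<close> lifts a loop to \<open>E\<close>, then \<open>\<Psi> \<circ> \<eta>\<close> lifts its image under \<open>R\<close> to \<open>E'\<close>, and one is closed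
  exactly when the other is. As both homomorphisms take only the values 0 and 1, this determines them.
\<close>

lemma monodromy_pullback:
  fixes E :: "'e::topological_space set" and E' :: "'f::topological_space set"
  assumes E: "double_covering E q P x \<phi>" and E': "double_covering E' q' P x \<phi>'"
    and R: "continuous_on P R" "R ` P \<subseteq> P" "R x = x"
    and \<Psi>: "continuous_on E \<Psi>" "\<Psi> ` E \<subseteq> E'" "\<And>e. e \<in> E \<Longrightarrow> q' (\<Psi> e) = R (q e)"
      "\<And>e e'. e \<in> E \<Longrightarrow> e' \<in> E \<Longrightarrow> q e = q e' \<Longrightarrow> \<Psi> e = \<Psi> e' \<Longrightarrow> e = e'"
    and \<gamma>: "\<gamma> \<in> carrier (fundamental_group P x)"
  shows "\<phi> \<gamma> = \<phi>' (fundamental_map P R \<gamma>)"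
proof -
  let ?G = "fundamental_group P x"
  have cov: "covering_space E q P"
    and hom_\<phi>: "\<phi> \<in> hom ?G (integer_mod_group 2)"
    and \<phi>: "\<And>\<eta>. path \<eta> \<Longrightarrow> path_image \<eta> \<subseteq> E \<Longrightarrow> q (pathstart \<eta>) = x \<Longrightarrow> q (pathfinish \<eta>) = x \<Longrightarrow>
        \<phi> (path_class P (q \<circ> \<eta>)) = 0 \<longleftrightarrow> pathfinish \<eta> = pathstart \<eta>"
    using E unfolding double_covering_def by blast+
  have hom_\<phi>': "\<phi>' \<in> hom ?G (integer_mod_group 2)"
    and \<phi>': "\<And>\<eta>. path \<eta> \<Longrightarrow> path_image \<eta> \<subseteq> E' \<Longrightarrow> q' (pathstart \<eta>) = x \<Longrightarrow> q' (pathfinish \<eta>) = x \<Longrightarrow>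
        \<phi>' (path_class P (q' \<circ> \<eta>)) = 0 \<longleftrightarrow> pathfinish \<eta> = pathstart \<eta>"
    using E' unfolding double_covering_def by blast+
  obtain \<alpha> where \<alpha>: "\<alpha> \<in> based_loops P x" "\<gamma> = path_class P \<alpha>"
    using \<gamma> by (auto simp: fundamental_group_def)
  have \<alpha>': "continuous_on {0..1} \<alpha>" "\<alpha> ` {0..1} \<subseteq> P" "\<alpha> 0 = x" "\<alpha> 1 = x"
    using \<alpha>(1) by (auto simp: based_loops_def path_def path_image_def pathstart_def pathfinish_def)
  then have "x \<in> q ` E" using covering_space_imp_surjective[OF cov] by force
  then obtain e where e: "e \<in> E" "q e = \<alpha> 0" using \<alpha>'(3) by auto
  obtain \<eta> where \<eta>: "continuous_on {0..1} \<eta>" "\<eta> ` {0..1} \<subseteq> E" "\<forall>t\<in>{0..1}. q (\<eta> t) = \<alpha> t"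
    using covering_space_path_lift[OF cov zero_le_one \<alpha>'(1,2) e] by blast
  have \<eta>E: "\<eta> 0 \<in> E" "\<eta> 1 \<in> E" "q (\<eta> 0) = x" "q (\<eta> 1) = x" using \<eta>(2,3) \<alpha>'(3,4) by auto
  have "path_class P \<alpha> = path_class P (q \<circ> \<eta>)"
  proof (rule path_class_eq, rule homotopic_paths_eq)
    show "path \<alpha>" "path_image \<alpha> \<subseteq> P" using \<alpha>(1) by (auto simp: based_loops_def)
  qed (use \<eta>(3) in simp)
  then have 1: "\<phi> \<gamma> = 0 \<longleftrightarrow> \<eta> 1 = \<eta> 0"
    using \<phi>[of \<eta>] \<eta>(1,2) \<eta>E \<alpha>(2) by (simp add: path_def path_image_def pathstart_def pathfinish_def)
  have "path_class P (R \<circ> \<alpha>) = path_class P (q' \<circ> (\<Psi> \<circ> \<eta>))"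
  proof (rule path_class_eq, rule homotopic_paths_eq)
    show "path (R \<circ> \<alpha>)" "path_image (R \<circ> \<alpha>) \<subseteq> P"
      using based_loop_image[OF \<alpha>(1) R(1,2)] by (auto simp: based_loops_def)
    show "(R \<circ> \<alpha>) t = (q' \<circ> (\<Psi> \<circ> \<eta>)) t" if "t \<in> {0..1}" for t
      using \<eta>(2,3) \<Psi>(3)[of "\<eta> t"] that by (auto simp: image_subset_iff)
  qed
  then have "fundamental_map P R \<gamma> = path_class P (q' \<circ> (\<Psi> \<circ> \<eta>))"
    using fundamental_map_path_class[OF \<alpha>(1) R(1,2)] \<alpha>(2) by simp
  moreover have "path (\<Psi> \<circ> \<eta>)" "path_image (\<Psi> \<circ> \<eta>) \<subseteq> E'"
    using \<eta>(1,2) \<Psi>(2) continuous_on_compose2[OF \<Psi>(1) \<eta>(1,2)]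
    by (auto simp: path_def path_image_def o_def)
  moreover have "q' (\<Psi> (\<eta> 0)) = x" "q' (\<Psi> (\<eta> 1)) = x" using \<eta>E \<Psi>(3) R(3) by auto
  ultimately have "\<phi>' (fundamental_map P R \<gamma>) = 0 \<longleftrightarrow> \<Psi> (\<eta> 1) = \<Psi> (\<eta> 0)"
    using \<phi>'[of "\<Psi> \<circ> \<eta>"] by (simp add: pathstart_def pathfinish_def)
  also have "\<dots> \<longleftrightarrow> \<eta> 1 = \<eta> 0" using \<Psi>(4)[of "\<eta> 1" "\<eta> 0"] \<eta>E by auto
  finally have 2: "\<phi>' (fundamental_map P R \<gamma>) = 0 \<longleftrightarrow> \<eta> 1 = \<eta> 0" .
  have "fundamental_map P R \<gamma> \<in> carrier ?G"
    using fundamental_map_hom[OF R(1,2), of x] \<gamma> R(3) by (auto simp: hom_def)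
  then have "\<phi> \<gamma> \<in> {0..<2}" "\<phi>' (fundamental_map P R \<gamma>) \<in> {0..<2}"
    using hom_\<phi> hom_\<phi>' \<gamma> by (auto simp: hom_def carrier_integer_mod_group Pi_iff)
  then show ?thesis using 1 2 by (cases "\<eta> 1 = \<eta> 0") auto
qed

theorem proposition4:
  fixes g :: nat and c :: int
    and F :: "'b::topological_space set" and \<kappa> :: "complex \<Rightarrow> 'b"
    and P :: "'p::topological_space set" and p :: "'p \<Rightarrow> 'b" and act :: "'p \<Rightarrow> complex \<Rightarrow> 'p"
    and x\<^sub>0 :: 'p and \<omega> :: "(real \<Rightarrow> complex) set" and u\<^sub>0 :: "(real \<Rightarrow> 'p) set"
    and E :: "'e::topological_space set" and q :: "'e \<Rightarrow> 'p"
    and E' :: "'e2::topological_space set" and q' :: "'e2 \<Rightarrow> 'p"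
    and \<phi> \<phi>' :: "(real \<Rightarrow> 'p) set \<Rightarrow> int"
  assumes "g \<ge> 1"
    and "oriented_surface g F \<kappa>"
    and "principal_circle_bundle P p F act"
    and "has_chern_number \<kappa> P p act c" and "even c"
    and "x\<^sub>0 \<in> P"
    and "circle_generator \<omega>" and "u\<^sub>0 = fiber_class P act x\<^sub>0 \<omega>"
    and "special_double_covering E q P x\<^sub>0 u\<^sub>0 \<phi>"
    and "special_double_covering E' q' P x\<^sub>0 u\<^sub>0 \<phi>'"
  shows "weakly_equivalent (fundamental_group P x\<^sub>0) \<phi> \<phi>'"
proof -
  obtain K where K: "continuous_on (cball 0 1) K" "K ` cball 0 1 \<subseteq> P" "\<forall>z\<in>cball 0 1. p (K z) = \<kappa> z"
    using assms(4) unfolding has_chern_number_def by (elim exE conjE) (rule that)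
  have \<kappa>: "quotient_map (top_of_set (cball 0 1)) (top_of_set F) \<kappa>"
    "\<forall>z\<in>cball 0 1. \<forall>w\<in>cball 0 1. \<kappa> z = \<kappa> w \<longleftrightarrow> equivclp (polygon_glue g) z w"
    using assms(2) unfolding oriented_surface_def by (rule conjunct1, rule conjunct2)
  interpret trivialized_cell \<kappa> F P p act K
    by (rule trivialized_cell.intro[OF \<kappa>(1) assms(3) K(1)]) (use K(2,3) in blast)+
  have glue: "\<And>z w. z \<in> cball 0 1 \<Longrightarrow> w \<in> cball 0 1 \<Longrightarrow>
      \<kappa> z = \<kappa> w \<longleftrightarrow> equivclp (polygon_glue g) z w"
    using \<kappa>(2) by blast
  have \<omega>: "\<omega> \<in> carrier (fundamental_group (sphere 0 1) 1)"
    using assms(7) by (simp add: circle_generator_def)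
  obtain L where L: "double_lift E q L"
    by (rule special_double_covering_lift[OF assms(9,8,6) \<omega>])
  obtain M where M: "double_lift E' q' M"
    by (rule special_double_covering_lift[OF assms(10,8,6) \<omega>])
  \<comment> \<open>Normalizing \<open>m\<close> at \<open>z0\<close> makes the gauge transformation fix the base point.\<close>
  obtain z0 t0 where x0: "z0 \<in> cball 0 1" "unwrap (z0, t0) = x\<^sub>0"
    using assms(6) by (rule unwrap_surj)
  obtain m where m: "continuous_on (cball 0 1) m" "m z0 = 0"
    "\<And>z w. z \<in> cball 0 1 \<Longrightarrow> w \<in> cball 0 1 \<Longrightarrow> \<kappa> z = \<kappa> w \<Longrightarrow> m z - m w \<in> \<int> \<and>
       (\<exists>c. \<forall>t. L (z, t) = L (w, c + t) \<and> M (z, t + m z) = M (w, c + t + m w))"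
    by (rule compatible_shift[OF L M assms(1) glue]) (assumption | rule that)+
  have mm: "m z - m w \<in> \<int>" if "z \<in> cball 0 1" "w \<in> cball 0 1" "\<kappa> z = \<kappa> w" for z w
    using m(3)[OF that] by simp
  obtain R where R: "continuous_on P R" "R ` P \<subseteq> P"
    "\<And>z t. z \<in> cball 0 1 \<Longrightarrow> R (unwrap (z, t)) = unwrap (z, t + m z)"
    by (rule gauge_transformation[OF m(1) mm]) (assumption | rule that)+
  \<comment> \<open>The gauge transformation for \<open>- m\<close> is the inverse of the one for \<open>m\<close>.\<close>
  have "continuous_on (cball 0 1) (\<lambda>z. - m z)" by (intro continuous_intros m)
  moreover have "- m z - (- m w) \<in> \<int>" if "z \<in> cball 0 1" "w \<in> cball 0 1" "\<kappa> z = \<kappa> w" for z w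
    using mm[of w z] that by simp
  ultimately obtain R' where R': "continuous_on P R'" "R' ` P \<subseteq> P"
    "\<And>z t. z \<in> cball 0 1 \<Longrightarrow> R' (unwrap (z, t)) = unwrap (z, t + - m z)"
    by (rule gauge_transformation) (assumption | rule that)+
  have base: "R x\<^sub>0 = x\<^sub>0" "R' x\<^sub>0 = x\<^sub>0"
    using R(3)[OF x0(1), of t0] R'(3)[OF x0(1), of t0] x0(2) m(2) by simp_all
  have inverse: "R' (R y) = y" "R (R' y) = y" if "y \<in> P" for y
  proof -
    obtain z t where "z \<in> cball 0 1" "unwrap (z, t) = y" using \<open>y \<in> P\<close> by (rule unwrap_surj)
    then show "R' (R y) = y" "R (R' y) = y" using R(3) R'(3) by force+
  qed
  have iso: "fundamental_map P R \<in> iso (fundamental_group P x\<^sub>0) (fundamental_group P x\<^sub>0)"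
    by (rule fundamental_map_iso[OF R(1,2) R'(1,2) inverse base])
  obtain \<Psi> where \<Psi>: "continuous_on E \<Psi>" "\<Psi> ` E \<subseteq> E'" "\<And>e. e \<in> E \<Longrightarrow> q' (\<Psi> e) = R (q e)"
    "\<And>e e'. e \<in> E \<Longrightarrow> e' \<in> E \<Longrightarrow> q e = q e' \<Longrightarrow> \<Psi> e = \<Psi> e' \<Longrightarrow> e = e'"
    by (rule double_lift_map[OF L M m(1) conjunct2[OF m(3)] R(3)]) (assumption | rule that)+
  have dc: "double_covering E q P x\<^sub>0 \<phi>" "double_covering E' q' P x\<^sub>0 \<phi>'"
    using assms(9,10) by (simp_all only: special_double_covering_def)
  have "\<phi> \<gamma> = \<phi>' (fundamental_map P R \<gamma>)"
    if \<gamma>: "\<gamma> \<in> carrier (fundamental_group P x\<^sub>0)" for \<gamma>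
  proof (rule monodromy_pullback[OF dc R(1,2) base(1) \<Psi>(1,2) _ _ \<gamma>])
    show "q' (\<Psi> e) = R (q e)" if "e \<in> E" for e using that by (rule \<Psi>(3))
    show "e = e'" if "e \<in> E" "e' \<in> E" "q e = q e'" "\<Psi> e = \<Psi> e'" for e e'
      using that by (rule \<Psi>(4))
  qed
  then show ?thesis using iso unfolding weakly_equivalent_def by blast
qed

end
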